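(* Let $X^{(1)},X^{(2)},Y,Z$ be independent non-negative random variables with $\tfrac12(\mathbb{E}[X^{(1)}]+\mathbb{E}[X^{(2)}])>\max\{\mathbb{E}[Y],\mathbb{E}[Z]\}$, let $(X_k)_{k\ge0}$ be the alternate renewal process driven by $X^{(1)},X^{(2)}$ and the Bernoulli variable $B$ (see context), and let $(Y_1,Z_1),(Y_2,Z_2),\ldots$ be i.i.d. copies of $(Y,Z)$ independent of $(X_k)$ and $B$. For $i=1,2$ define $U^{(i)}:=Y-X^{(i)}$ and $V^{(i)}:=Z-X^{(i)}$ and assume $\mathbb{P}(U^{(i)}>0)>0$ and $\mathbb{P}(V^{(i)}>0)>0$. For $k\ge1$ put $$T^1_k:=\sup_{k\le i<\infty}\big((Y_k-X_k)+\cdots+(Y_i-X_i)\big),$$ $$T^2_k:=\sup_{k\le i<j<\infty}\big((Z_k-X_k)+\cdots+(Z_i-X_i)+(Y_{i+1}-X_{i+1})+\cdots+(Y_j-X_j)\big).$$ (a) The coupled integral equations, for $i=1,2$ and all $(u,v)\in\overline{\mathbb{R}}^2$, $$\mathbb{E}\left[\mathbf{1}_{\{u+X^{(i)}\ge Y\}}\,\psi_i\big((u-U^{(i)})\wedge(v-V^{(i)}),\,v-V^{(i)}\big)\right]=\psi_{3-i}(u,v)$$ admit a unique solution $(\psi_1,\psi_2)$ in the class of bounded functions on $\overline{\mathbb{R}}^2$ having the limits $\psi_i(\infty,\infty)=\lim_{u,v\to\infty}\psi_i(u,v)=1$. It is given by $\psi_i(u,v):=\mathbb{P}(T^1_1\le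 u,\ T^2_1\le v\mid B=i)$. (b) Let $\gamma_i:\overline{\mathbb{R}}^2\to(-\infty,K_\gamma]$, $i=1,2$, for some finite $K_\gamma$, satisfy for all $(u,v)\in\operatorname{supp}(\gamma_1\vee\gamma_2\vee0)$ and $i=1,2$ $$\mathbb{E}\left[\mathbf{1}_{\{u+X^{(i)}\ge Y\}}\,\gamma_i\big((u-U^{(i)})\wedge(v-V^{(i)}),\,v-V^{(i)}\big)\right]\ge\gamma_{3-i}(u,v).$$ If $\gamma_i(\infty,\infty):=\limsup_{u,v\to\infty}\gamma_i(u,v)=1$ for $i=1,2$, then $\psi_i\ge\gamma_i$ for $i=1,2$. (c) Let $\eta_i:\overline{\mathbb{R}}^2\to[0,\infty)$, $i=1,2$, satisfy for all $(u,v)\in\operatorname{supp}(\psi_1\vee\psi_2)$ with $v\ge u$ and $i=1,2$ $$\mathbb{E}\left[\mathbf{1}_{\{u+X^{(i)}\ge Y\}}\,\eta_i\big((u-U^{(i)})\wedge(v-V^{(i)}),\,v-V^{(i)}\big)\right]\le\eta_{3-i}(u,v).$$ If $\eta_i(\infty,\infty):=\liminf_{u,v\to\infty}\eta_i(u,v)=1$ for $i=1,2$, then $\psi_i(u,v)\le\eta_i(u,v)$ for all $v\ge u$ and $i=1,2$. In (b) and (c), $\psi_1,\psi_2$ are the functions from (a).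
   Context: Alternate renewal (AR) process: $B$ takes the values $1$ and $2$ with probability $1/2$ each; $(X^{(1)}_k,X^{(2)}_k)$, $k\ge0$, are i.i.d. copies of $(X^{(1)},X^{(2)})$, independent of $B$; and $X_{2k}:=X^{(B)}_k$, $X_{2k+1}:=X^{(3-B)}_k$ for $k\ge0$. Thus $B$ determines the distribution of $X_0$, and the distributions of the subsequent $X_k$ alternate. Notation: $\overline{\mathbb{R}}:=\mathbb{R}\cup\{\pm\infty\}$ with its usual topology and $\pm\infty-x=\pm\infty$ for real $x$; $u\wedge v:=\min\{u,v\}$, $u\vee v:=\max\{u,v\}$; $\operatorname{supp}(\phi):=\{x:\phi(x)\ne0\}$ and, for functions joined with $\vee0$, $\operatorname{supp}(\phi\vee0):=\{x:\phi(x)>0\}$. All functions are Borel measurable. Limits as $u,v\to\infty$ are over $(u,v)\in\overline{\mathbb{R}}^2$, $(u,v)\to(\infty,\infty)$. *)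

theory Defs
  imports "HOL-Probability.Probability"
begin

text \<open>The library's \<^const>\<open>prob_space.indep_var\<close> forces both random variables to have the same value
  type; this is the same notion for random variables of different types.\<close>

definition indep_rv ::
  "'a measure \<Rightarrow> 'b measure \<Rightarrow> ('a \<Rightarrow> 'b) \<Rightarrow> 'c measure \<Rightarrow> ('a \<Rightarrow> 'c) \<Rightarrow> bool" where
  "indep_rv M N1 X1 N2 X2 \<longleftrightarrow>
     X1 \<in> measurable M N1 \<and> X2 \<in> measurable M N2 \<and>
     prob_space.indep_set M {X1 -` A \<inter> space M |A. A \<in> sets N1}
                            {X2 -` A \<inter> space M |A. A \<in> sets N2}"

lemma (in prob_space) indep_rv_iff_indep_var:
  "indep_rv M N1 X1 N2 X2 \<longleftrightarrow> indep_var N1 X1 N2 X2"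
proof -
  have "(\<lambda>i. {case_bool X1 X2 i -` A \<inter> space M |A. A \<in> sets (case_bool N1 N2 i)}) =
      case_bool {X1 -` A \<inter> space M |A. A \<in> sets N1} {X2 -` A \<inter> space M |A. A \<in> sets N2}"
    by (rule ext) (simp split: bool.split)
  then show ?thesis
    by (auto simp: indep_rv_def indep_var_def indep_vars_def2 indep_set_def UNIV_bool)
qed

text \<open>Expectation as positive part minus negative part, with values in the extended reals.
  The Bochner integral would silently give the value 0 to a function that is bounded above but has
  infinite negative part, whereas the expectation of such a function is \<open>-\<infinity>\<close>.
  It is only meaningful if not both parts are infinite.\<close>

definition ext_expectation :: "'a measure \<Rightarrow> ('a \<Rightarrow> real) \<Rightarrow> ereal" where
  "ext_expectation M f =
     enn2ereal (\<integral>\<^sup>+\<omega>. ennreal (f \<omega>) \<partial>M) - enn2ereal (\<integral>\<^sup>+\<omega>. ennreal (- f \<omega>) \<partial>M)"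

lemma ext_expectation_integrable:
  assumes "integrable M f"
  shows "ext_expectation M f = ereal (integral\<^sup>L M f)"
proof -
  obtain r q where rq: "0 \<le> r" "0 \<le> q"
      "(\<integral>\<^sup>+\<omega>. ennreal (f \<omega>) \<partial>M) = ennreal r"
      "(\<integral>\<^sup>+\<omega>. ennreal (- f \<omega>) \<partial>M) = ennreal q"
      "integral\<^sup>L M f = r - q"
    by (rule integrableE[OF assms]) auto
  then show ?thesis
    by (simp add: ext_expectation_def enn2ereal_ennreal)
qed

lemma ext_expectation_nonneg:
  assumes "\<And>\<omega>. 0 \<le> f \<omega>"
  shows "ext_expectation M f = enn2ereal (\<integral>\<^sup>+\<omega>. ennreal (f \<omega>) \<partial>M)"
  using assms by (simp add: ext_expectation_def ennreal_neg zero_ennreal.rep_eq)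

definition ar_process :: "('a \<Rightarrow> nat) \<Rightarrow> (nat \<Rightarrow> nat \<Rightarrow> 'a \<Rightarrow> real) \<Rightarrow> nat \<Rightarrow> 'a \<Rightarrow> real" where
  "ar_process B Xs k \<omega> =
     (if even k then Xs (B \<omega>) (k div 2) \<omega> else Xs (3 - B \<omega>) (k div 2) \<omega>)"

definition sup_walk1 ::
  "(nat \<Rightarrow> 'a \<Rightarrow> real) \<Rightarrow> (nat \<Rightarrow> 'a \<Rightarrow> real) \<Rightarrow> nat \<Rightarrow> 'a \<Rightarrow> ereal" where
  "sup_walk1 X Y k \<omega> = (SUP i\<in>{k..}. ereal (\<Sum>l=k..i. Y l \<omega> - X l \<omega>))"

definition sup_walk2 ::
  "(nat \<Rightarrow> 'a \<Rightarrow> real) \<Rightarrow> (nat \<Rightarrow> 'a \<Rightarrow> real) \<Rightarrow> (nat \<Rightarrow> 'a \<Rightarrow> real) \<Rightarrow> nat \<Rightarrow> 'a \<Rightarrow> ereal" where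
  "sup_walk2 X Y Z k \<omega> =
     (SUP (i, j)\<in>{(i, j). k \<le> i \<and> i < j}.
        ereal ((\<Sum>l=k..i. Z l \<omega> - X l \<omega>) + (\<Sum>l=i+1..j. Y l \<omega> - X l \<omega>)))"

definition psi ::
  "'a measure \<Rightarrow> ('a \<Rightarrow> nat) \<Rightarrow> (nat \<Rightarrow> 'a \<Rightarrow> real) \<Rightarrow> (nat \<Rightarrow> 'a \<Rightarrow> real) \<Rightarrow> (nat \<Rightarrow> 'a \<Rightarrow> real)
     \<Rightarrow> nat \<Rightarrow> ereal \<times> ereal \<Rightarrow> real" where
  "psi M B X Y Z i = (\<lambda>(u, v).
     \<P>(\<omega> in M. sup_walk1 X Y 1 \<omega> \<le> u \<and> sup_walk2 X Y Z 1 \<omega> \<le> v \<bar> B \<omega> = i))"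

definition ar_op ::
  "'a measure \<Rightarrow> ('a \<Rightarrow> real) \<Rightarrow> ('a \<Rightarrow> real) \<Rightarrow> ('a \<Rightarrow> real)
     \<Rightarrow> (ereal \<times> ereal \<Rightarrow> real) \<Rightarrow> ereal \<Rightarrow> ereal \<Rightarrow> ereal" where
  "ar_op M X Y Z f u v = ext_expectation M (\<lambda>\<omega>.
     indicat_real {\<omega>. u + ereal (X \<omega>) \<ge> ereal (Y \<omega>)} \<omega> *
     f (min (u - ereal (Y \<omega> - X \<omega>)) (v - ereal (Z \<omega> - X \<omega>)), v - ereal (Z \<omega> - X \<omega>)))"

text \<open>Here \<open>at\<close> is the punctured filter: the limit and the value at the corner are
  required separately, and both are needed for uniqueness. The equations alone only say that the
  two functions agree at the corner.\<close>

definition ar_solution ::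
  "'a measure \<Rightarrow> (nat \<Rightarrow> 'a \<Rightarrow> real) \<Rightarrow> ('a \<Rightarrow> real) \<Rightarrow> ('a \<Rightarrow> real)
     \<Rightarrow> (nat \<Rightarrow> ereal \<times> ereal \<Rightarrow> real) \<Rightarrow> bool" where
  "ar_solution M X Y Z f \<longleftrightarrow> (\<forall>i\<in>{1, 2}.
     f i \<in> borel_measurable borel \<and> bounded (range (f i)) \<and>
     f i (\<infinity>, \<infinity>) = 1 \<and> (f i \<longlongrightarrow> 1) (at (\<infinity>, \<infinity>)) \<and>
     (\<forall>u v. ar_op M (X i) Y Z (f i) u v = ereal (f (3 - i) (u, v))))"

end

theory Submission
  imports Defs
begin

text \<open>
  Put \<open>(u, v)\<close> into motion: in each step subtract an increment \<open>V\<close> from \<open>v\<close>, replace \<open>u\<close> by the smaller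
  of \<open>u - U\<close> and the new \<open>v\<close>, and kill the pair when \<open>U > u\<close>. Unfolding the recursion shows that the
  pair is alive after \<open>n\<close> steps iff the partial sums with at most \<open>n\<close> terms in \<open>T\<^sup>1\<close> and \<open>T\<^sup>2\<close> stay below
  \<open>u\<close> and \<open>v\<close> (\<open>survives_iff\<close>). So \<open>\<psi>\<^sub>i(u, v)\<close> is the probability that the pair is never killed, and the
  expectation in the integral equations is the one-step operator \<open>kill_op\<close> of this killed chain.
  The functions \<open>\<psi>\<^sub>i\<close> are the limit of the iterates of this operator on the constant 1, hence they
  solve the equations.

  Comparison rests on one fact: a pair with \<open>u \<le> c\<close> is killed within a fixed number of steps with
  probability bounded away from 0, because \<open>U\<close> exceeds some positive height with positive probability
  (\<open>uniform_killing\<close>). Therefore the probability of being alive after \<open>n\<close> steps with \<open>u \<le> c\<close> is at most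
  a constant times the probability of dying between times \<open>n\<close> and \<open>n + m\<close>, which tends to 0
  (\<open>kill_iter_low_tendsto_0\<close>). After one step \<open>u \<le> v\<close>, so a surviving pair ends up with both coordinates
  above \<open>c\<close>. A bounded nonnegative subsolution that is at most \<open>a\<close> there is at most \<open>a\<close> times the survival
  probability, and a nonnegative supersolution on \<open>u \<le> v\<close> that is at least \<open>a\<close> there is at least \<open>a\<close> times it
  on \<open>u \<le> v\<close>. Letting \<open>a\<close> tend to 1 gives (b) and (c). For (b) the negative part of \<open>\<gamma>\<close> is cut off;
  for (c) \<open>\<eta>\<^sub>i\<close> is set to 0 where \<open>\<psi>\<^sub>i\<close> vanishes, which keeps it a supersolution because \<open>\<psi>\<close> solves the
  equations. For uniqueness, (b)
  applies to a solution \<open>\<phi>\<close> and to its reflection \<open>2\<psi> - \<phi>\<close>, which is again a solution.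

  The limit \<open>\<psi>\<^sub>i \<rightarrow> 1\<close> says that \<open>T\<^sup>1\<close> and \<open>T\<^sup>2\<close> are finite almost surely. Only first moments are
  available, so this is proved by the argument of the maximal ergodic lemma
  (\<open>bounded_by_negative_drift\<close>): on the event that the running maximum is unbounded, one step changes
  it in the long run by exactly the increment, while by stationarity its mean cannot decrease; a
  negative mean increment then forces the event to be null. It is used for \<open>T\<^sup>1\<close> first and then for
  \<open>T\<^sup>2\<close>, after truncating the \<open>X\<close> at a level that keeps the drift negative.

  All this takes place on the space of independent copies of the sample space of \<open>(X\<^sup>(\<^sup>1\<^sup>), X\<^sup>(\<^sup>2\<^sup>), Y, Z)\<close>,
  where the two laws of \<open>X\<close> are used in turn. Given \<open>B = i\<close> the observed steps have the same joint
  law as these (\<open>distr_observed_given_B\<close>), with the law \<open>3 - i\<close> used first, since the walks start at index 1.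
  The two laws are indexed by truth values, so that passing to the other law is negation.
\<close>

section \<open>Walks killed at the boundary\<close>

fun step :: "real \<Rightarrow> real \<Rightarrow> ereal \<times> ereal \<Rightarrow> ereal \<times> ereal" where
  "step a b (u, v) = (min (u - ereal a) (v - ereal b), v - ereal b)"

text \<open>The sequences \<open>U\<close> and \<open>V\<close> are the increments still to come, so a step passes on their tails.\<close>

fun survives :: "(nat \<Rightarrow> real) \<Rightarrow> (nat \<Rightarrow> real) \<Rightarrow> nat \<Rightarrow> ereal \<times> ereal \<Rightarrow> bool" where
  "survives U V 0 p \<longleftrightarrow> True"
| "survives U V (Suc n) p \<longleftrightarrow> ereal (U 0) \<le> fst p \<and>
     survives (\<lambda>k. U (Suc k)) (\<lambda>k. V (Suc k)) n (step (U 0) (V 0) p)"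

lemma ereal_add_le_iff: "ereal (a + b) \<le> x \<longleftrightarrow> ereal b \<le> x - ereal a"
  by (cases x) auto

text \<open>The second coordinate collects the \<open>V\<close>-increments from the start; the minimum in \<^const>\<open>step\<close> offers at each time the choice
  to switch from the \<open>V\<close>-increments to the \<open>U\<close>-increments. All switching times have to be survived, whence the sums
  with a switch after index \<open>i\<close>.\<close>

lemma survives_iff:
  "survives U V n (u, v) \<longleftrightarrow>
     (\<forall>j<n. ereal (\<Sum>l\<le>j. U l) \<le> u) \<and>
     (\<forall>i j. i < j \<and> j < n \<longrightarrow> ereal ((\<Sum>l\<le>i. V l) + (\<Sum>l=Suc i..j. U l)) \<le> v)"
proof (induction n arbitrary: U V u v)
  case 0
  show ?case by simp
next
  case (Suc n)
  have 1: "(\<forall>j<Suc n. ereal (\<Sum>l\<le>j. U l) \<le> u) \<longleftrightarrow>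
      ereal (U 0) \<le> u \<and> (\<forall>j<n. ereal (\<Sum>l\<le>j. U (Suc l)) \<le> u - ereal (U 0))"
    by (simp only: All_less_Suc2 sum.atMost_Suc_shift ereal_add_le_iff atMost_0) simp
  have shift: "(\<Sum>l=Suc (Suc i)..Suc j. U l) = (\<Sum>l=Suc i..j. U (Suc l))" for i j
    by (rule sum.shift_bounds_cl_Suc_ivl)
  have 2: "(\<forall>i j. i < j \<and> j < Suc n \<longrightarrow> ereal ((\<Sum>l\<le>i. V l) + (\<Sum>l=Suc i..j. U l)) \<le> v) \<longleftrightarrow>
      (\<forall>j<n. ereal (\<Sum>l\<le>j. U (Suc l)) \<le> v - ereal (V 0)) \<and>
      (\<forall>i j. i < j \<and> j < n \<longrightarrow>
        ereal ((\<Sum>l\<le>i. V (Suc l)) + (\<Sum>l=Suc i..j. U (Suc l))) \<le> v - ereal (V 0))"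
    (is "?L \<longleftrightarrow> ?R1 \<and> ?R2")
  proof (intro iffI conjI allI impI)
    fix j assume L: ?L and "j < n"
    then have "ereal ((\<Sum>l\<le>0. V l) + (\<Sum>l=Suc 0..Suc j. U l)) \<le> v"
      by blast
    then have "ereal (V 0 + (\<Sum>l=Suc 0..Suc j. U l)) \<le> v"
      by (simp only: atMost_0 sum.insert_if finite.emptyI sum.empty empty_iff if_False add_0_right)
    then show "ereal (\<Sum>l\<le>j. U (Suc l)) \<le> v - ereal (V 0)"
      unfolding ereal_add_le_iff sum.shift_bounds_cl_Suc_ivl atMost_atLeast0 .
  next
    fix i j assume L: ?L and "i < j \<and> j < n"
    then have "ereal ((\<Sum>l\<le>Suc i. V l) + (\<Sum>l=Suc (Suc i)..Suc j. U l)) \<le> v"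
      by blast
    then show "ereal ((\<Sum>l\<le>i. V (Suc l)) + (\<Sum>l=Suc i..j. U (Suc l))) \<le> v - ereal (V 0)"
      unfolding shift sum.atMost_Suc_shift add.assoc ereal_add_le_iff .
  next
    fix i j assume R: "?R1 \<and> ?R2" and ij: "i < j \<and> j < Suc n"
    then obtain j' where j': "j = Suc j'" "j' < n" by (cases j) auto
    show "ereal ((\<Sum>l\<le>i. V l) + (\<Sum>l=Suc i..j. U l)) \<le> v"
    proof (cases i)
      case 0
      then show ?thesis
        using R j' by (simp only: ereal_add_le_iff sum.shift_bounds_cl_Suc_ivl atMost_0 atMost_atLeast0[symmetric]) simp
    next
      case (Suc i')
      with R j' ij show ?thesis
        by (simp only: shift sum.atMost_Suc_shift add.assoc ereal_add_le_iff) simp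
    qed
  qed
  show ?case
    unfolding 1 2 by (auto simp: Suc.IH)
qed

lemma survives_all_iff_sup_walks:
  "(\<forall>n. survives (\<lambda>k. Y (Suc k) \<omega> - X (Suc k) \<omega>) (\<lambda>k. Z (Suc k) \<omega> - X (Suc k) \<omega>) n (u, v)) \<longleftrightarrow>
     sup_walk1 X Y 1 \<omega> \<le> u \<and> sup_walk2 X Y Z 1 \<omega> \<le> v"
proof -
  define U V where "U = (\<lambda>k. Y k \<omega> - X k \<omega>)" and "V = (\<lambda>k. Z k \<omega> - X k \<omega>)"
  have sh: "(\<Sum>l\<le>j. f (Suc l)) = (\<Sum>l=1..Suc j. f l)" for j and f :: "nat \<Rightarrow> real"
    unfolding One_nat_def sum.shift_bounds_cl_Suc_ivl atMost_atLeast0 ..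
  have sh': "(\<Sum>l=Suc i..j. f (Suc l)) = (\<Sum>l=Suc i+1..Suc j. f l)" for i j and f :: "nat \<Rightarrow> real"
    by (simp only: add_Suc_right add_0_right One_nat_def sum.shift_bounds_cl_Suc_ivl)
  have 1: "(\<forall>j. ereal (\<Sum>l\<le>j. U (Suc l)) \<le> u) \<longleftrightarrow> sup_walk1 X Y 1 \<omega> \<le> u"
    (is "?L = ?R")
  proof
    assume L: ?L
    have "ereal (\<Sum>l=1..j. U l) \<le> u" if "1 \<le> j" for j
      using L[rule_format, of "j - 1"] that by (simp only: sh) simp
    then show ?R
      unfolding sup_walk1_def SUP_le_iff U_def by auto
  next
    assume ?R
    then have "ereal (\<Sum>l=1..j. U l) \<le> u" if "1 \<le> j" for j
      using that unfolding sup_walk1_def SUP_le_iff U_def by auto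
    then show ?L
      unfolding sh by (simp del: sum.cl_ivl_Suc)
  qed
  have 2: "(\<forall>i j. i < j \<longrightarrow>
        ereal ((\<Sum>l\<le>i. V (Suc l)) + (\<Sum>l=Suc i..j. U (Suc l))) \<le> v) \<longleftrightarrow> sup_walk2 X Y Z 1 \<omega> \<le> v"
    (is "?L = ?R")
  proof
    assume L: ?L
    have "ereal ((\<Sum>l=1..i. V l) + (\<Sum>l=i+1..j. U l)) \<le> v" if "1 \<le> i" "i < j" for i j
      using L[rule_format, of "i - 1" "j - 1"] that by (simp only: sh sh') simp
    then show ?R
      unfolding sup_walk2_def SUP_le_iff U_def V_def by auto
  next
    assume ?R
    then have "ereal ((\<Sum>l=1..i. V l) + (\<Sum>l=i+1..j. U l)) \<le> v" if "1 \<le> i" "i < j" for i j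
      using that unfolding sup_walk2_def SUP_le_iff U_def V_def by auto
    then show ?L
      unfolding sh sh' by (simp del: sum.cl_ivl_Suc)
  qed
  show ?thesis
    unfolding 1[symmetric] 2[symmetric] unfolding survives_iff U_def V_def by blast
qed

text \<open>The maximum of 0 and the first \<open>n\<close> partial sums, and its analogue for sums that may switch once from \<open>V\<close> to \<open>U\<close>,
  built backwards in time: prepending a step is what interacts well with stationarity.\<close>

fun ladder1 :: "(nat \<Rightarrow> real) \<Rightarrow> nat \<Rightarrow> real" where
  "ladder1 U 0 = 0"
| "ladder1 U (Suc n) = max 0 (U 0 + ladder1 (\<lambda>k. U (Suc k)) n)"

fun ladder2 :: "(nat \<Rightarrow> real) \<Rightarrow> (nat \<Rightarrow> real) \<Rightarrow> nat \<Rightarrow> real" where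
  "ladder2 U V 0 = 0"
| "ladder2 U V (Suc n) = max (ladder1 U (Suc n)) (V 0 + ladder2 (\<lambda>k. U (Suc k)) (\<lambda>k. V (Suc k)) n)"

lemma ladder1_nonneg: "0 \<le> ladder1 U n"
  by (cases n) auto

lemma ladder1_le_ladder2: "ladder1 U n \<le> ladder2 U V n"
  by (cases n) auto

text \<open>The walk that survives may have smaller increments than the one that defines the bounds; this is how
  a truncation of the \<open>X\<close> enters.\<close>

lemma survives_if_ladders_le:
  assumes "\<And>k. U k \<le> U' k" "\<And>k. V k \<le> V' k"
    and "ereal (ladder1 U' n) \<le> u" "ereal (ladder2 U' V' n) \<le> v"
  shows "survives U V n (u, v)"
  using assms
proof (induction n arbitrary: U V U' V' u v)
  case 0
  show ?case by simp
next
  case (Suc n)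
  let ?p = "ladder1 (\<lambda>k. U' (Suc k)) n"
  let ?g = "ladder2 (\<lambda>k. U' (Suc k)) (\<lambda>k. V' (Suc k)) n"
  have pg: "0 \<le> ?p" "?p \<le> ?g"
    by (rule ladder1_nonneg ladder1_le_ladder2)+
  have u: "ereal (U' 0 + ?p) \<le> u" and v: "ereal (V' 0 + ?g) \<le> v"
    using Suc.prems(3,4) by (auto simp: max_def split: if_splits intro: order_trans[rotated])
  have u2: "ereal ?p \<le> u - ereal (U 0)"
    using u Suc.prems(1)[of 0] by (cases u) auto
  have v2: "ereal ?g \<le> v - ereal (V 0)"
    using v Suc.prems(2)[of 0] by (cases v) auto
  have "ereal (U 0) \<le> u"
    using u Suc.prems(1)[of 0] pg(1) by (cases u) auto
  moreover have "ereal ?p \<le> min (u - ereal (U 0)) (v - ereal (V 0))"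
    using u2 v2 pg(2) by (auto intro: order_trans[OF _ v2])
  then have "survives (\<lambda>k. U (Suc k)) (\<lambda>k. V (Suc k)) n (step (U 0) (V 0) (u, v))"
    using v2 unfolding step.simps by (intro Suc.IH[OF Suc.prems(1,2)])
  ultimately show ?case by simp
qed

section \<open>The killing operator and its comparison principle\<close>

lemma step_alt: "step a b p = (min (fst p - ereal a) (snd p - ereal b), snd p - ereal b)"
  by (cases p) simp

lemma fst_step_le_snd_step: "fst (step a b p) \<le> snd (step a b p)"
  by (simp add: step_alt)

lemma measurable_fst_ereal [measurable]: "fst \<in> borel_measurable (borel :: (ereal \<times> ereal) measure)"
  by (intro borel_measurable_continuous_onI continuous_intros)

lemma measurable_snd_ereal [measurable]: "snd \<in> borel_measurable (borel :: (ereal \<times> ereal) measure)"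
  by (intro borel_measurable_continuous_onI continuous_intros)

lemma measurable_step [measurable]:
  assumes [measurable]: "f \<in> borel_measurable N" "g \<in> borel_measurable N" "h \<in> borel_measurable N"
  shows "(\<lambda>x. step (f x) (g x) (h x)) \<in> borel_measurable N"
  unfolding step_alt by measurable

lemma nn_integral_if_1_0:
  assumes "{\<omega> \<in> space M. P \<omega>} \<in> sets M"
  shows "(\<integral>\<^sup>+\<omega>. (if P \<omega> then 1 else 0) \<partial>M) = emeasure M {\<omega> \<in> space M. P \<omega>}"
  unfolding nn_integral_indicator[OF assms, symmetric]
  by (rule nn_integral_cong) auto

locale killed_walk = prob_space M for M :: "'a measure" +
  fixes U V :: "bool \<Rightarrow> 'a \<Rightarrow> real"
  assumes U_measurable [measurable]: "\<And>s. U s \<in> borel_measurable M"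
    and V_measurable [measurable]: "\<And>s. V s \<in> borel_measurable M"
begin

definition kill_op :: "bool \<Rightarrow> (ereal \<times> ereal \<Rightarrow> ennreal) \<Rightarrow> ereal \<times> ereal \<Rightarrow> ennreal" where
  "kill_op s f p =
     (\<integral>\<^sup>+\<omega>. (if ereal (U s \<omega>) \<le> fst p then 1 else 0) * f (step (U s \<omega>) (V s \<omega>) p) \<partial>M)"

fun kill_iter ::
  "nat \<Rightarrow> (bool \<Rightarrow> ereal \<times> ereal \<Rightarrow> ennreal) \<Rightarrow> bool \<Rightarrow> ereal \<times> ereal \<Rightarrow> ennreal" where
  "kill_iter 0 f s p = f s p"
| "kill_iter (Suc n) f s p = kill_op s (kill_iter n f (\<not> s)) p"

lemma kill_op_measurable [measurable]:
  assumes [measurable]: "f \<in> borel_measurable borel"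
  shows "kill_op s f \<in> borel_measurable borel"
  unfolding kill_op_def[abs_def] by measurable

lemma kill_iter_measurable [measurable]:
  assumes [measurable]: "\<And>s. f s \<in> borel_measurable borel"
  shows "kill_iter n f s \<in> borel_measurable borel"
proof (induction n arbitrary: s)
  case 0
  show ?case by simp
next
  case (Suc n)
  then have "kill_op s (kill_iter n f (\<not> s)) \<in> borel_measurable borel"
    by measurable
  then show ?case by (simp cong: measurable_cong)
qed

text \<open>After a step the first coordinate is at most the second, so inequalities need only hold for such pairs.\<close>

lemma kill_op_mono:
  assumes "\<And>p. fst p \<le> snd p \<Longrightarrow> f p \<le> g p"
  shows "kill_op s f p \<le> kill_op s g p"
  unfolding kill_op_def
  by (intro nn_integral_mono mult_left_mono assms fst_step_le_snd_step) simp

lemma kill_iter_mono: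
  assumes "\<And>s p. fst p \<le> snd p \<Longrightarrow> f s p \<le> g s p" and "fst p \<le> snd p \<or> 0 < n"
  shows "kill_iter n f s p \<le> kill_iter n g s p"
  using assms(2)
proof (induction n arbitrary: s p)
  case 0
  then show ?case by (simp add: assms(1))
next
  case (Suc n)
  then show ?case by (auto intro!: kill_op_mono)
qed

lemma kill_op_add_cmult:
  assumes [measurable]: "f \<in> borel_measurable borel" "g \<in> borel_measurable borel"
  shows "kill_op s (\<lambda>p. a * f p + b * g p) p = a * kill_op s f p + b * kill_op s g p"
proof -
  show ?thesis
    unfolding kill_op_def distrib_left mult.left_commute[of _ a] mult.left_commute[of _ b]
    by (subst nn_integral_add) (simp_all add: nn_integral_cmult)
qed

lemma kill_iter_add_cmult:
  assumes [measurable]: "\<And>s. f s \<in> borel_measurable borel" "\<And>s. g s \<in> borel_measurable borel"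
  shows "kill_iter n (\<lambda>s p. a * f s p + b * g s p) s p =
    a * kill_iter n f s p + b * kill_iter n g s p"
proof (induction n arbitrary: s p)
  case (Suc n)
  have "kill_iter n (\<lambda>s p. a * f s p + b * g s p) (\<not> s) =
      (\<lambda>p. a * kill_iter n f (\<not> s) p + b * kill_iter n g (\<not> s) p)"
    using Suc by blast
  then show ?case by (simp add: kill_op_add_cmult)
qed simp

lemma kill_iter_add: "kill_iter (m + n) f s p = kill_iter m (kill_iter n f) s p"
proof (induction m arbitrary: s p)
  case (Suc m)
  then have "kill_iter (m + n) f (\<not> s) = kill_iter m (kill_iter n f) (\<not> s)"
    by blast
  then show ?case by simp
qed simp

definition alive :: "nat \<Rightarrow> bool \<Rightarrow> ereal \<times> ereal \<Rightarrow> ennreal" where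
  "alive n = kill_iter n (\<lambda>_ _. 1)"

definition survival :: "bool \<Rightarrow> ereal \<times> ereal \<Rightarrow> ennreal" where
  "survival s p = (INF n. alive n s p)"

lemma alive_0: "alive 0 s p = 1"
  by (simp add: alive_def)

lemma alive_Suc: "alive (Suc n) s p = kill_op s (alive n (\<not> s)) p"
  by (simp add: alive_def)

lemma alive_measurable [measurable]: "alive n s \<in> borel_measurable borel"
  unfolding alive_def by measurable

lemma survival_measurable [measurable]: "survival s \<in> borel_measurable borel"
  unfolding survival_def by measurable

lemma kill_op_le_1:
  assumes "\<And>p. f p \<le> 1"
  shows "kill_op s f p \<le> 1"
proof -
  have "kill_op s f p \<le> (\<integral>\<^sup>+\<omega>. 1 \<partial>M)"
    unfolding kill_op_def
    by (intro nn_integral_mono) (auto simp: assms)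
  then show ?thesis by (simp add: emeasure_space_1)
qed

lemma alive_le_1: "alive n s p \<le> 1"
  by (induction n arbitrary: s p) (auto simp: alive_0 alive_Suc intro!: kill_op_le_1)

lemma alive_decseq: "decseq (\<lambda>n. alive n s p)"
proof -
  have "alive (Suc n) s p \<le> alive n s p" for n s p
  proof (induction n arbitrary: s p)
    case 0
    show ?case by (simp add: alive_0 alive_le_1)
  next
    case (Suc n)
    then show ?case
      unfolding alive_Suc[of "Suc n"] alive_Suc[of n] by (intro kill_op_mono)
  qed
  then show ?thesis by (rule decseq_SucI)
qed

lemma survival_le_alive: "survival s p \<le> alive n s p"
  unfolding survival_def by (rule INF_lower) simp

lemma survival_le_1: "survival s p \<le> 1"
  using survival_le_alive[of s p 0] by (simp add: alive_0)

lemma alive_tendsto_survival: "(\<lambda>n. alive n s p) \<longlonglongrightarrow> survival s p"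
  unfolding survival_def by (rule LIMSEQ_INF) (rule alive_decseq)

text \<open>Dominated convergence in the recursion of the iterates.\<close>

lemma survival_fixed_point: "survival s p = kill_op s (survival (\<not> s)) p"
proof (rule LIMSEQ_unique)
  show "(\<lambda>n. alive (Suc n) s p) \<longlonglongrightarrow> survival s p"
    by (rule LIMSEQ_Suc[OF alive_tendsto_survival])
  show "(\<lambda>n. alive (Suc n) s p) \<longlonglongrightarrow> kill_op s (survival (\<not> s)) p"
    unfolding alive_Suc kill_op_def
  proof (rule nn_integral_dominated_convergence[where w="\<lambda>_. 1"])
    show "AE x in M. (\<lambda>i. (if ereal (U s x) \<le> fst p then 1 else 0) * alive i (\<not> s) (step (U s x) (V s x) p))
      \<longlonglongrightarrow> (if ereal (U s x) \<le> fst p then 1 else 0) * survival (\<not> s) (step (U s x) (V s x) p)"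
      by (auto intro!: alive_tendsto_survival)
  qed (auto simp: emeasure_space_1 alive_le_1)
qed

end

locale killed_walk_pos = killed_walk +
  assumes U_pos: "\<And>s. prob {\<omega> \<in> space M. 0 < U s \<omega>} > 0"
begin

text \<open>Continuity of the measure turns \<open>P(U > 0) > 0\<close> into a bound for some height \<open>h > 0\<close>, common to both laws.\<close>

lemma uniform_upward_steps:
  obtains h d where "0 < h" "0 < d" "\<And>s. ennreal d \<le> emeasure M {\<omega> \<in> space M. h < U s \<omega>}"
proof -
  have "\<exists>h d. 0 < h \<and> 0 < d \<and> d \<le> prob {\<omega> \<in> space M. h < U s \<omega>}" for s
  proof -
    define r where "r = (\<lambda>n. inverse (real (Suc n)))"
    let ?A = "\<lambda>n. {\<omega> \<in> space M. r n < U s \<omega>}"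
    have r: "0 < r n" "r (Suc n) \<le> r n" for n
      unfolding r_def by (auto intro!: le_imp_inverse_le)
    have "incseq ?A"
      by (intro incseq_SucI Collect_mono conj_mono imp_refl impI le_less_trans[OF r(2)])
    moreover have "(\<Union>n. ?A n) = {\<omega> \<in> space M. 0 < U s \<omega>}"
    proof (intro set_eqI iffI)
      fix \<omega> assume "\<omega> \<in> (\<Union>n. ?A n)"
      then show "\<omega> \<in> {\<omega> \<in> space M. 0 < U s \<omega>}" using r(1) less_trans by blast
    next
      fix \<omega> assume "\<omega> \<in> {\<omega> \<in> space M. 0 < U s \<omega>}"
      then show "\<omega> \<in> (\<Union>n. ?A n)" unfolding r_def using reals_Archimedean[of "U s \<omega>"] by blast
    qed
    moreover have "range ?A \<subseteq> events" by auto
    ultimately have "(\<lambda>n. prob (?A n)) \<longlonglongrightarrow> prob {\<omega> \<in> space M. 0 < U s \<omega>}"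
      using finite_Lim_measure_incseq[of ?A] by presburger
    then have "eventually (\<lambda>n. 0 < prob (?A n)) sequentially"
      using U_pos by (rule order_tendstoD)
    then obtain n where "0 < prob (?A n)"
      by (auto simp: eventually_sequentially)
    then show ?thesis
      using r(1) by (intro exI[of _ "r n"] exI[of _ "prob (?A n)"]) auto
  qed
  then obtain h d where hd: "\<And>s. 0 < h s \<and> 0 < d s \<and> d s \<le> prob {\<omega> \<in> space M. h s < U s \<omega>}"
    by metis
  show thesis
  proof
    show "0 < min (h True) (h False)" "0 < min (d True) (d False)"
      using hd by auto
    fix s
    have h: "min (h True) (h False) \<le> h s"
      by (cases s) auto
    have "min (d True) (d False) \<le> d s"
      by (cases s) auto
    also have "d s \<le> prob {\<omega> \<in> space M. h s < U s \<omega>}"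
      using hd by blast
    also have "\<dots> \<le> prob {\<omega> \<in> space M. min (h True) (h False) < U s \<omega>}"
      by (rule finite_measure_mono) (use h in auto)
    finally show "ennreal (min (d True) (d False)) \<le> emeasure M {\<omega> \<in> space M. min (h True) (h False) < U s \<omega>}"
      unfolding emeasure_eq_measure by (rule ennreal_leI)
  qed
qed

text \<open>If \<open>u \<le> m h\<close>, then \<open>m + 1\<close> consecutive increments above \<open>h\<close> kill the pair.\<close>

lemma uniform_killing:
  obtains m d where "0 < d" "d < top" "\<And>s p. fst p \<le> ereal c \<Longrightarrow> alive m s p + d \<le> 1"
proof -
  obtain h d where hd: "0 < h" "0 < d" "\<And>s. ennreal d \<le> emeasure M {\<omega> \<in> space M. h < U s \<omega>}"
    by (rule uniform_upward_steps) blast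
  have killing: "alive (Suc m) s p + ennreal d ^ Suc m \<le> 1" if "fst p \<le> ereal (real m * h)" for m s p
    using that
  proof (induction m arbitrary: s p)
    case 0
    have "alive (Suc 0) s p = emeasure M {\<omega> \<in> space M. ereal (U s \<omega>) \<le> fst p}"
      unfolding alive_Suc kill_op_def alive_0 by (simp add: nn_integral_if_1_0)
    then have "alive (Suc 0) s p + ennreal d ^ Suc 0 \<le>
        emeasure M {\<omega> \<in> space M. ereal (U s \<omega>) \<le> fst p} + emeasure M {\<omega> \<in> space M. h < U s \<omega>}"
      using hd(3)[of s] by (simp add: add_left_mono)
    also have "emeasure M {\<omega> \<in> space M. ereal (U s \<omega>) \<le> fst p} + emeasure M {\<omega> \<in> space M. h < U s \<omega>} =
        emeasure M ({\<omega> \<in> space M. ereal (U s \<omega>) \<le> fst p} \<union> {\<omega> \<in> space M. h < U s \<omega>})"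
    proof (rule plus_emeasure)
      have "\<not> (ereal x \<le> fst p \<and> h < x)" for x
        using 0 hd(1) by (cases "fst p") auto
      then show "{\<omega> \<in> space M. ereal (U s \<omega>) \<le> fst p} \<inter> {\<omega> \<in> space M. h < U s \<omega>} = {}"
        by auto
    qed measurable
    also have "\<dots> \<le> 1"
      by (rule measure_le_1)
    finally show ?case .
  next
    case (Suc m)
    let ?I = "\<lambda>\<omega>. if h < U s \<omega> then 1 else 0 :: ennreal"
    let ?K = "\<lambda>\<omega>. (if ereal (U s \<omega>) \<le> fst p then 1 else 0) * alive (Suc m) (\<not> s) (step (U s \<omega>) (V s \<omega>) p)"
    have "ennreal d \<le> (\<integral>\<^sup>+\<omega>. ?I \<omega> \<partial>M)"
      using hd(3)[of s]
      by (simp add: nn_integral_if_1_0)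
    then have "alive (Suc (Suc m)) s p + ennreal d ^ Suc (Suc m) \<le>
        (\<integral>\<^sup>+\<omega>. ?K \<omega> \<partial>M) + ennreal d ^ Suc m * (\<integral>\<^sup>+\<omega>. ?I \<omega> \<partial>M)"
      unfolding alive_Suc[of "Suc m"] kill_op_def power_Suc[of _ "Suc m"] mult.commute[of "ennreal d"]
      by (intro add_left_mono mult_left_mono) auto
    also have "\<dots> = (\<integral>\<^sup>+\<omega>. ?K \<omega> + ennreal d ^ Suc m * ?I \<omega> \<partial>M)"
      by (simp add: nn_integral_add nn_integral_cmult)
    also have "\<dots> \<le> (\<integral>\<^sup>+\<omega>. 1 \<partial>M)"
    proof (rule nn_integral_mono)
      fix \<omega>
      show "?K \<omega> + ennreal d ^ Suc m * ?I \<omega> \<le> 1"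
      proof (cases "h < U s \<omega>")
        case True
        have "fst (step (U s \<omega>) (V s \<omega>) p) \<le> ereal (real m * h)"
        proof -
          have "fst (step (U s \<omega>) (V s \<omega>) p) \<le> fst p - ereal (U s \<omega>)"
            by (simp add: step_alt)
          also have "\<dots> \<le> ereal (real m * h)"
            using Suc.prems True by (cases "fst p") (auto simp: algebra_simps)
          finally show ?thesis .
        qed
        from Suc.IH[OF this, of "\<not> s"]
        have *: "alive (Suc m) (\<not> s) (step (U s \<omega>) (V s \<omega>) p) + ennreal d ^ Suc m \<le> 1" .
        have "ennreal d ^ Suc m \<le> 1"
          by (rule order_trans[OF _ *]) (rule add_increasing[OF zero_le order_refl])
        then show ?thesis
          using True * by (simp del: power_Suc)
      qed (simp add: alive_le_1)
    qed
    also have "\<dots> = 1"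
      by (simp add: emeasure_space_1)
    finally show ?case .
  qed
  obtain m :: nat where m: "c < real m * h"
    using hd(1) reals_Archimedean3 by blast
  show thesis
  proof
    show "0 < ennreal d ^ Suc m" "ennreal d ^ Suc m < top"
      using hd(2) zero_less_power[OF hd(2), of "Suc m"] less_imp_le[OF hd(2)]
      by (simp_all only: ennreal_power ennreal_less_top ennreal_0[symmetric] ennreal_less_iff)
    show "alive (Suc m) s p + ennreal d ^ Suc m \<le> 1" if "fst p \<le> ereal c" for s p
      using that m by (intro killing) (cases "fst p", auto)
  qed
qed

text \<open>The region where \<open>u\<close> is bounded above, from which killing is uniformly likely.\<close>

definition low :: "real \<Rightarrow> bool \<Rightarrow> ereal \<times> ereal \<Rightarrow> ennreal" where
  "low c s p = (if fst p \<le> ereal c then 1 else 0)"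

lemma low_measurable [measurable]: "low c s \<in> borel_measurable borel"
  unfolding low_def by measurable

text \<open>Being alive at time \<open>n\<close> in the low region leads to death before time \<open>n + m\<close> with probability at least \<open>d\<close>, so
  \<open>d\<close> times its probability is at most the difference of two terms of a convergent sequence.\<close>

lemma kill_iter_low_tendsto_0: "(\<lambda>n. kill_iter n (low c) s p) \<longlonglongrightarrow> 0"
proof -
  obtain m d where d: "0 < d" "d < top" and kill: "\<And>s p. fst p \<le> ereal c \<Longrightarrow> alive m s p + d \<le> 1"
    by (rule uniform_killing) blast
  have dominate: "d * kill_iter n (low c) s p \<le> alive n s p - alive (n + m) s p" for n
  proof -
    have "d * kill_iter n (low c) s p + 1 * kill_iter n (alive m) s p =
        kill_iter n (\<lambda>s p. d * low c s p + 1 * alive m s p) s p"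
      by (rule kill_iter_add_cmult[symmetric]) measurable
    also have "\<dots> \<le> alive n s p"
    proof (cases n)
      case 0
      then show ?thesis using kill[of p s] by (auto simp: low_def alive_0 alive_le_1 add.commute)
    next
      case (Suc k)
      show ?thesis
        unfolding alive_def[of n] using Suc kill
        by (intro kill_iter_mono) (auto simp: low_def alive_le_1 add.commute)
    qed
    also have "kill_iter n (alive m) s p = alive (n + m) s p"
      unfolding alive_def kill_iter_add ..
    finally show ?thesis
      using alive_le_1[of "n + m" s p]
      by (intro ennreal_le_minus_iff[THEN iffD2] disjI1) (auto simp: add.commute)
  qed
  have "(\<lambda>n. alive n s p - alive (n + m) s p) \<longlonglongrightarrow> survival s p - survival s p"
    using survival_le_1[of s p]
    by (intro tendsto_diff_ennreal alive_tendsto_survival LIMSEQ_ignore_initial_segment)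
       (auto simp: top_unique)
  moreover have "survival s p - survival s p = 0"
    using survival_le_1[of s p] by (cases "survival s p") (auto simp: ennreal_minus_if top_unique)
  ultimately have lim: "(\<lambda>n. alive n s p - alive (n + m) s p) \<longlonglongrightarrow> 0"
    by simp
  have "(\<lambda>n. d * kill_iter n (low c) s p) \<longlonglongrightarrow> 0"
  proof (rule tendsto_sandwich[OF _ _ tendsto_const lim])
    show "\<forall>\<^sub>F n in sequentially. d * kill_iter n (low c) s p \<le> alive n s p - alive (n + m) s p"
      by (rule always_eventually) (rule allI, rule dominate)
  qed simp
  then have "(\<lambda>n. inverse d * (d * kill_iter n (low c) s p)) \<longlonglongrightarrow> inverse d * 0"
    by (rule ennreal_tendsto_cmult[rotated]) (use d in \<open>auto simp: less_top[symmetric]\<close>)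
  moreover have "inverse d * (d * x) = x" for x
    using d ennreal_mult_divide_eq[of d x] by (simp add: divide_ennreal_def ac_simps)
  ultimately show ?thesis
    by simp
qed

text \<open>A subsolution is below its iterates. After \<open>n \<ge> 1\<close> steps the pair is killed, or low, or has both coordinates
  above \<open>c\<close>; the low part contributes at most \<open>K\<close> times a null sequence.\<close>

lemma sub_solution_le_survival:
  assumes [measurable]: "\<And>s. g s \<in> borel_measurable borel"
    and bound: "\<And>s p. g s p \<le> K" and K: "K < top"
    and sub: "\<And>s p. g s p \<le> kill_op s (g (\<not> s)) p"
    and corner: "\<And>s p. ereal c < fst p \<Longrightarrow> ereal c < snd p \<Longrightarrow> g s p \<le> a" and a: "a < top"
  shows "g s p \<le> a * survival s p"
proof (rule LIMSEQ_le_const)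
  have "(\<lambda>n. a * alive n s p + K * kill_iter n (low c) s p) \<longlonglongrightarrow> a * survival s p + K * 0"
    using a K by (intro tendsto_add ennreal_tendsto_cmult alive_tendsto_survival kill_iter_low_tendsto_0) auto
  then show "(\<lambda>n. a * alive n s p + K * kill_iter n (low c) s p) \<longlonglongrightarrow> a * survival s p"
    by simp
  have iterate: "g s p \<le> kill_iter n g s p" for n s p
  proof (induction n arbitrary: s p)
    case (Suc n)
    have "g s p \<le> kill_op s (g (\<not> s)) p" by (rule sub)
    also have "\<dots> \<le> kill_op s (kill_iter n g (\<not> s)) p"
      by (rule kill_op_mono) (rule Suc)
    finally show ?case by simp
  qed simp
  have "g s p \<le> a * alive n s p + K * kill_iter n (low c) s p" if "1 \<le> n" for n
  proof -
    have "g s p \<le> kill_iter n g s p" by (rule iterate)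
    also have "\<dots> \<le> kill_iter n (\<lambda>s p. a * 1 + K * low c s p) s p"
    proof (rule kill_iter_mono)
      fix s and p :: "ereal \<times> ereal" assume p: "fst p \<le> snd p"
      show "g s p \<le> a * 1 + K * low c s p"
      proof (cases "fst p \<le> ereal c")
        case True
        then show ?thesis using bound[of s p] by (simp add: low_def add_increasing)
      next
        case False
        with p have "ereal c < fst p" "ereal c < snd p" by auto
        with False show ?thesis using corner[of p s] by (simp add: low_def)
      qed
    qed (use that in auto)
    also have "\<dots> = a * alive n s p + K * kill_iter n (low c) s p"
      unfolding alive_def by (rule kill_iter_add_cmult) measurable
    finally show ?thesis .
  qed
  then show "\<exists>N. \<forall>n\<ge>N. g s p \<le> a * alive n s p + K * kill_iter n (low c) s p"
    by blast
qed

text \<open>The mirror image of the preceding argument. In the low region \<open>h\<close> is estimated from below by 0, at the price of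
  \<open>a\<close> times a null sequence.\<close>

lemma survival_le_super_solution:
  assumes [measurable]: "\<And>s. h s \<in> borel_measurable borel"
    and super: "\<And>s p. fst p \<le> snd p \<Longrightarrow> kill_op s (h (\<not> s)) p \<le> h s p"
    and corner: "\<And>s p. ereal c < fst p \<Longrightarrow> ereal c < snd p \<Longrightarrow> a \<le> h s p" and a: "a < top"
    and p: "fst p \<le> snd p"
  shows "a * survival s p \<le> h s p"
proof (rule LIMSEQ_le)
  show "(\<lambda>n. a * alive n s p) \<longlonglongrightarrow> a * survival s p"
    using a by (intro ennreal_tendsto_cmult alive_tendsto_survival) auto
  have "(\<lambda>n. h s p + a * kill_iter n (low c) s p) \<longlonglongrightarrow> h s p + a * 0"
    using a by (intro tendsto_add tendsto_const ennreal_tendsto_cmult kill_iter_low_tendsto_0) auto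
  then show "(\<lambda>n. h s p + a * kill_iter n (low c) s p) \<longlonglongrightarrow> h s p"
    by simp
  have iterate: "kill_iter n h s p \<le> h s p" if "fst p \<le> snd p" for n s p
    using that
  proof (induction n arbitrary: s p)
    case (Suc n)
    have "kill_op s (kill_iter n h (\<not> s)) p \<le> kill_op s (h (\<not> s)) p"
      by (rule kill_op_mono) (rule Suc)
    also have "\<dots> \<le> h s p" by (rule super) fact
    finally show ?case by simp
  qed simp
  have "a * alive n s p \<le> h s p + a * kill_iter n (low c) s p" for n
  proof -
    have "a * alive n s p = kill_iter n (\<lambda>s p. a * 1 + 0 * 1) s p"
      unfolding alive_def by (subst kill_iter_add_cmult) auto
    also have "\<dots> \<le> kill_iter n (\<lambda>s p. 1 * h s p + a * low c s p) s p"
    proof (rule kill_iter_mono)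
      fix s and p :: "ereal \<times> ereal" assume p: "fst p \<le> snd p"
      show "a * 1 + 0 * 1 \<le> 1 * h s p + a * low c s p"
      proof (cases "fst p \<le> ereal c")
        case True
        then show ?thesis by (simp add: low_def)
      next
        case False
        with p have "ereal c < fst p" "ereal c < snd p" by auto
        with False show ?thesis using corner[of p s] by (simp add: low_def)
      qed
    qed (use p in auto)
    also have "\<dots> = 1 * kill_iter n h s p + a * kill_iter n (low c) s p"
      by (rule kill_iter_add_cmult) measurable
    also have "\<dots> \<le> h s p + a * kill_iter n (low c) s p"
      using iterate[OF p] by (auto intro: add_right_mono)
    finally show ?thesis .
  qed
  then show "\<exists>N. \<forall>n\<ge>N. a * alive n s p \<le> h s p + a * kill_iter n (low c) s p"
    by blast
qed

end

section \<open>Independent steps as a product space\<close>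

text \<open>The law that governs step \<open>n\<close> when law \<open>s\<close> governs step 0.\<close>

definition turn :: "bool \<Rightarrow> nat \<Rightarrow> bool" where
  "turn s n = (if even n then s else \<not> s)"

definition alternating :: "(bool \<Rightarrow> 'a \<Rightarrow> real) \<Rightarrow> bool \<Rightarrow> (nat \<Rightarrow> 'a) \<Rightarrow> nat \<Rightarrow> real" where
  "alternating F s \<omega> n = F (turn s n) (\<omega> n)"

definition shift :: "(nat \<Rightarrow> 'a) \<Rightarrow> nat \<Rightarrow> 'a" where
  "shift \<omega> n = \<omega> (Suc n)"

lemma turn_0 [simp]: "turn s 0 = s"
  and turn_Suc: "turn s (Suc n) = turn (\<not> s) n"
  by (auto simp: turn_def)

lemma alternating_0: "alternating F s \<omega> 0 = F s (\<omega> 0)"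
  by (simp add: alternating_def)

lemma alternating_Suc: "alternating F s \<omega> (Suc n) = alternating F (\<not> s) (shift \<omega>) n"
  by (simp add: alternating_def turn_Suc shift_def)

text \<open>The starting point may be random, since the induction passes to the point after one step.\<close>

lemma survives_measurable [measurable]:
  assumes [measurable]: "\<And>k. (\<lambda>\<omega>. F k \<omega>) \<in> borel_measurable N" "\<And>k. (\<lambda>\<omega>. G k \<omega>) \<in> borel_measurable N"
    "h \<in> borel_measurable N"
  shows "Measurable.pred N (\<lambda>\<omega>. survives (\<lambda>k. F k \<omega>) (\<lambda>k. G k \<omega>) n (h \<omega>))"
  using assms
proof (induction n arbitrary: F G h)
  case 0
  show ?case by simp
next
  case (Suc n)
  note [measurable] = Suc.prems
  have "Measurable.pred N (\<lambda>\<omega>. survives (\<lambda>k. F (Suc k) \<omega>) (\<lambda>k. G (Suc k) \<omega>) n (step (F 0 \<omega>) (G 0 \<omega>) (h \<omega>)))"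
    by (rule Suc.IH) measurable
  then show ?case
    unfolding survives.simps by measurable
qed

context prob_space
begin

abbreviation paths :: "(nat \<Rightarrow> 'a) measure" where
  "paths \<equiv> PiM UNIV (\<lambda>_. M)"

lemma sequence_space_paths: "sequence_space M"
  by unfold_locales

lemmas paths_iter = sequence_space.PiM_iter[OF sequence_space_paths]

lemma coordinate_measurable [measurable]: "(\<lambda>\<omega>. \<omega> n) \<in> paths \<rightarrow>\<^sub>M M"
  by (rule measurable_component_singleton) simp

lemma case_nat_measurable [measurable]: "(\<lambda>(x, \<omega>). case_nat x \<omega>) \<in> M \<Otimes>\<^sub>M paths \<rightarrow>\<^sub>M paths"
  by measurable

lemma shift_measurable [measurable]: "shift \<in> paths \<rightarrow>\<^sub>M paths"
  unfolding shift_def[abs_def] by (rule measurable_PiM_single') (auto simp: space_PiM PiE_iff)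

lemma alternating_measurable [measurable]:
  assumes "\<And>s. F s \<in> borel_measurable M"
  shows "(\<lambda>\<omega>. alternating F s \<omega> n) \<in> borel_measurable paths"
  unfolding alternating_def
  by (rule measurable_compose[OF coordinate_measurable assms])

lemma prob_space_paths: "prob_space paths"
  by (rule prob_space_PiM) unfold_locales

lemma shift_case_nat [simp]: "shift (case_nat x \<omega>) = \<omega>"
  by (auto simp: shift_def)

text \<open>Splitting off the first step: the first coordinate and the shifted path are independent, and the
  latter is distributed like the path.\<close>

lemma nn_integral_paths:
  assumes [measurable]: "f \<in> borel_measurable paths"
  shows "(\<integral>\<^sup>+\<omega>. f \<omega> \<partial>paths) = (\<integral>\<^sup>+x. \<integral>\<^sup>+\<omega>. f (case_nat x \<omega>) \<partial>paths \<partial>M)"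
proof -
  interpret P: prob_space paths by (rule prob_space_paths)
  have "(\<integral>\<^sup>+\<omega>. f \<omega> \<partial>paths) = (\<integral>\<^sup>+\<omega>. f \<omega> \<partial>distr (M \<Otimes>\<^sub>M paths) paths (\<lambda>(x, \<omega>). case_nat x \<omega>))"
    unfolding paths_iter ..
  also have "\<dots> = (\<integral>\<^sup>+y. f (case y of (x, \<omega>) \<Rightarrow> case_nat x \<omega>) \<partial>(M \<Otimes>\<^sub>M paths))"
    by (rule nn_integral_distr[OF case_nat_measurable]) (simp add: assms)
  also have "\<dots> = (\<integral>\<^sup>+x. \<integral>\<^sup>+\<omega>. f (case (x, \<omega>) of (x, \<omega>) \<Rightarrow> case_nat x \<omega>) \<partial>paths \<partial>M)"
    by (rule P.nn_integral_fst[OF measurable_compose[OF case_nat_measurable assms], symmetric])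
  finally show ?thesis by simp
qed

lemma distr_shift: "distr paths paths shift = paths"
proof (rule measure_eqI)
  fix A assume "A \<in> sets (distr paths paths shift)"
  then have A [measurable]: "A \<in> sets paths" by simp
  have "emeasure (distr paths paths shift) A = (\<integral>\<^sup>+\<omega>. indicator A \<omega> \<partial>distr paths paths shift)"
    by simp
  also have "\<dots> = (\<integral>\<^sup>+\<omega>. indicator A (shift \<omega>) \<partial>paths)"
    by (rule nn_integral_distr) measurable
  also have "\<dots> = (\<integral>\<^sup>+x. \<integral>\<^sup>+\<omega>. indicator A \<omega> \<partial>paths \<partial>M)"
    by (subst nn_integral_paths) simp_all
  also have "\<dots> = emeasure paths A"
    by (simp add: emeasure_space_1)
  finally show "emeasure (distr paths paths shift) A = emeasure paths A" .
qed simp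

lemma
  fixes f :: "_ \<Rightarrow> real"
  assumes [measurable]: "integrable paths f"
  shows integrable_shift: "integrable paths (\<lambda>\<omega>. f (shift \<omega>))"
    and integral_shift: "(\<integral>\<omega>. f (shift \<omega>) \<partial>paths) = (\<integral>\<omega>. f \<omega> \<partial>paths)"
proof -
  show "integrable paths (\<lambda>\<omega>. f (shift \<omega>))"
    using assms by (intro integrable_distr[OF shift_measurable]) (simp add: distr_shift)
  show "(\<integral>\<omega>. f (shift \<omega>) \<partial>paths) = (\<integral>\<omega>. f \<omega> \<partial>paths)"
    using integral_distr[OF shift_measurable, of f] by (simp add: distr_shift)
qed

lemma distr_coordinate: "distr paths M (\<lambda>\<omega>. \<omega> n) = M"
  by (rule product_prob_space.PiM_component) (use sequence_space_paths in \<open>auto simp: sequence_space_def\<close>)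

lemma integrable_coordinate:
  fixes f :: "_ \<Rightarrow> real"
  assumes "integrable M f"
  shows "integrable paths (\<lambda>\<omega>. f (\<omega> n))"
  using assms by (intro integrable_distr[OF coordinate_measurable]) (simp add: distr_coordinate)

lemma integral_coordinate_times_shift:
  fixes f :: "_ \<Rightarrow> real"
  assumes f: "integrable M f" and [measurable]: "A \<in> sets paths"
  shows "(\<integral>\<omega>. f (\<omega> 0) * indicator A (shift \<omega>) \<partial>paths) = (\<integral>x. f x \<partial>M) * measure paths A"
proof -
  interpret P: prob_space paths by (rule prob_space_paths)
  interpret MP: pair_prob_space M paths ..
  note [measurable] = borel_measurable_integrable[OF f]
  have "(\<integral>\<omega>. f (\<omega> 0) * indicator A (shift \<omega>) \<partial>paths) =
      (\<integral>\<omega>. f (\<omega> 0) * indicator A (shift \<omega>) \<partial>distr (M \<Otimes>\<^sub>M paths) paths (\<lambda>(x, \<omega>). case_nat x \<omega>))"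
    unfolding paths_iter ..
  also have "\<dots> = (\<integral>y. f (fst y) * indicator A (snd y) \<partial>(M \<Otimes>\<^sub>M paths))"
    by (subst integral_distr) (auto intro!: Bochner_Integration.integral_cong simp: split_beta')
  also have "\<dots> = (\<integral>x. \<integral>\<omega>. f x * indicator A \<omega> \<partial>paths \<partial>M)"
  proof -
    have "integrable (M \<Otimes>\<^sub>M paths) (\<lambda>(x, \<omega>). f x * indicator A \<omega>)"
    proof (rule Bochner_Integration.integrable_bound)
      show "integrable (M \<Otimes>\<^sub>M paths) (\<lambda>y. f (fst y))"
        using f by (intro integrable_distr[OF measurable_fst]) (simp add: P.distr_pair_fst)
    qed (auto simp: indicator_def split_beta')
    from MP.integral_fst'[OF this] show ?thesis
      by (simp add: split_beta')
  qed
  also have "\<dots> = (\<integral>x. f x \<partial>M) * measure paths A"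
    by simp
  finally show ?thesis .
qed

end

context killed_walk
begin

text \<open>By induction: the first step of the path yields the integral in \<^const>\<open>kill_op\<close>, the shifted path the iterate for the other law.\<close>

lemma alive_eq_paths:
  "alive n s p = emeasure paths {\<omega> \<in> space paths. survives (alternating U s \<omega>) (alternating V s \<omega>) n p}"
proof (induction n arbitrary: s p)
  case 0
  interpret P: prob_space paths by (rule prob_space_paths)
  show ?case by (simp add: alive_0 P.emeasure_space_1)
next
  case (Suc n)
  let ?S = "\<lambda>n s p \<omega>. survives (alternating U s \<omega>) (alternating V s \<omega>) n p"
  have ind: "(\<integral>\<^sup>+\<omega>. (if ?S n s p \<omega> then 1 else 0) \<partial>paths) = emeasure paths {\<omega> \<in> space paths. ?S n s p \<omega>}" for n s p
    by (rule nn_integral_if_1_0) measurable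
  have "emeasure paths {\<omega> \<in> space paths. ?S (Suc n) s p \<omega>} =
      (\<integral>\<^sup>+x. \<integral>\<^sup>+\<omega>. (if ?S (Suc n) s p (case_nat x \<omega>) then 1 else 0) \<partial>paths \<partial>M)"
    unfolding ind[symmetric] by (rule nn_integral_paths) measurable
  also have "\<dots> = (\<integral>\<^sup>+x. (if ereal (U s x) \<le> fst p then 1 else 0) *
      (\<integral>\<^sup>+\<omega>. (if ?S n (\<not> s) (step (U s x) (V s x) p) \<omega> then 1 else 0) \<partial>paths) \<partial>M)"
    by (intro nn_integral_cong) (simp add: alternating_0 alternating_Suc del: survives_iff)
  also have "\<dots> = alive (Suc n) s p"
    unfolding ind Suc.IH[symmetric] alive_Suc kill_op_def ..
  finally show ?case by simp
qed

lemma survival_eq_paths: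
  "survival s p = emeasure paths {\<omega> \<in> space paths. \<forall>n. survives (alternating U s \<omega>) (alternating V s \<omega>) n p}"
proof -
  interpret P: prob_space paths by (rule prob_space_paths)
  let ?A = "\<lambda>n. {\<omega> \<in> space paths. survives (alternating U s \<omega>) (alternating V s \<omega>) n p}"
  have "decseq ?A"
    by (intro decseq_SucI Collect_mono conj_mono imp_refl impI)
       (cases p, auto simp: survives_iff)
  then have "(INF n. emeasure paths (?A n)) = emeasure paths (\<Inter>n. ?A n)"
    by (intro INF_emeasure_decseq) auto
  also have "(\<Inter>n. ?A n) = {\<omega> \<in> space paths. \<forall>n. survives (alternating U s \<omega>) (alternating V s \<omega>) n p}"
    by auto
  finally show ?thesis
    by (simp add: survival_def alive_eq_paths)
qed

end

section \<open>Negative drift makes the suprema finite\<close>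

lemma ladder1_mono: "ladder1 U n \<le> ladder1 U (Suc n)"
proof (induction n arbitrary: U)
  case (Suc n)
  from Suc[of "\<lambda>k. U (Suc k)"] show ?case
    unfolding ladder1.simps(2)[of U "Suc n"] ladder1.simps(2)[of U n] by linarith
qed simp

context prob_space
begin

text \<open>The maximal ergodic argument. Let \<open>A\<^sub>s\<close> be the event that \<open>G\<^sub>n\<close> is unbounded when law \<open>s\<close> comes first. It is
  almost surely invariant: \<open>\<omega> \<in> A\<^sub>s\<close> iff the shifted path is in the event for the other law. On it, \<open>R\<^sub>n\<close> is
  eventually irrelevant, so \<open>G\<^sub>n\<^sub>+\<^sub>1(\<omega>) - G\<^sub>n(shift \<omega>)\<close> converges to the first increment. Summed over both laws, the
  integrals of these differences over the events are nonnegative, since the shift preserves the measure and \<open>G\<close>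
  increases. The first increment is independent of the event for the shifted path, so the limit of the integrals is
  the common probability \<open>p\<close> of the events times the sum of the mean increments. Hence \<open>p = 0\<close>.

  The term \<open>R\<close> makes room for \<^const>\<open>ladder2\<close>, whose recursion involves \<^const>\<open>ladder1\<close>; the function \<open>H\<close> provides the
  integrable majorant.\<close>

lemma bounded_by_negative_drift:
  fixes G R :: "nat \<Rightarrow> bool \<Rightarrow> (nat \<Rightarrow> 'a) \<Rightarrow> real" and V H :: "bool \<Rightarrow> 'a \<Rightarrow> real"
  assumes V: "\<And>s. integrable M (V s)" and H: "\<And>s. integrable M (H s)"
    and R_measurable: "\<And>n s. R n s \<in> borel_measurable paths"
    and G_0: "\<And>s \<omega>. G 0 s \<omega> = 0"
    and G_Suc: "\<And>n s \<omega>. G (Suc n) s \<omega> = max (R n s \<omega>) (V s (\<omega> 0) + G n (\<not> s) (shift \<omega>))"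
    and R_nonneg: "\<And>n s \<omega>. 0 \<le> R n s \<omega>"
    and R_mono: "\<And>n s \<omega>. R n s \<omega> \<le> R (Suc n) s \<omega>"
    and R_le: "\<And>n s \<omega>. R n s \<omega> \<le> H s (\<omega> 0) + G n (\<not> s) (shift \<omega>)"
    and R_bounded: "\<And>s. AE \<omega> in paths. \<exists>C. \<forall>n. R n s \<omega> \<le> C"
    and drift: "(\<integral>x. V True x \<partial>M) + (\<integral>x. V False x \<partial>M) < 0"
  shows "AE \<omega> in paths. \<exists>C. \<forall>n. G n s \<omega> \<le> C"
proof -
  interpret P: prob_space paths by (rule prob_space_paths)
  note [measurable] = borel_measurable_integrable[OF V] borel_measurable_integrable[OF H] R_measurable
  have G_measurable [measurable]: "G n s \<in> borel_measurable paths" for n s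
  proof (induction n arbitrary: s)
    case 0
    then show ?case by (simp add: G_0[abs_def])
  next
    case (Suc n)
    note [measurable] = Suc
    show ?case unfolding G_Suc[abs_def] by measurable
  qed
  have G_nonneg: "0 \<le> G n s \<omega>" for n s \<omega>
    using R_nonneg[of "n - 1" s \<omega>] by (cases n) (auto simp: G_0 G_Suc)
  have G_mono: "G n s \<omega> \<le> G (Suc n) s \<omega>" for n s \<omega>
  proof (induction n arbitrary: s \<omega>)
    case 0
    show ?case using G_nonneg[of 1] by (simp add: G_0)
  next
    case (Suc n)
    show ?case
      unfolding G_Suc[of "Suc n" s \<omega>] G_Suc[of n s \<omega>] using R_mono[of n s \<omega>] Suc[of "\<not> s" "shift \<omega>"] by linarith
  qed
  then have G_le: "m \<le> n \<Longrightarrow> G m s \<omega> \<le> G n s \<omega>" for m n s \<omega>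
    by (rule lift_Suc_mono_le)
  have V0: "integrable paths (\<lambda>\<omega>. V s (\<omega> 0))" and H0: "integrable paths (\<lambda>\<omega>. H s (\<omega> 0))" for s
    by (rule integrable_coordinate V H)+
  have G_integrable: "integrable paths (G n s)" for n s
  proof (induction n arbitrary: s)
    case 0
    then show ?case by (simp add: G_0[abs_def])
  next
    case (Suc n)
    have "integrable paths (\<lambda>\<omega>. \<bar>H s (\<omega> 0)\<bar> + \<bar>V s (\<omega> 0)\<bar> + G n (\<not> s) (shift \<omega>))"
      by (intro Bochner_Integration.integrable_add integrable_abs H0 V0 integrable_shift Suc)
    then show ?case
    proof (rule Bochner_Integration.integrable_bound)
      show "AE \<omega> in paths. norm (G (Suc n) s \<omega>) \<le> norm (\<bar>H s (\<omega> 0)\<bar> + \<bar>V s (\<omega> 0)\<bar> + G n (\<not> s) (shift \<omega>))"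
      proof (rule AE_I2)
        fix \<omega>
        show "norm (G (Suc n) s \<omega>) \<le> norm (\<bar>H s (\<omega> 0)\<bar> + \<bar>V s (\<omega> 0)\<bar> + G n (\<not> s) (shift \<omega>))"
          using G_nonneg[of "Suc n" s \<omega>] G_nonneg[of n "\<not> s" "shift \<omega>"] R_le[of n s \<omega>]
          unfolding G_Suc real_norm_def by linarith
      qed
    qed measurable
  qed
  define A where "A s = {\<omega> \<in> space paths. \<forall>C::nat. \<exists>n. real C < G n s \<omega>}" for s
  have A_sets [measurable]: "A s \<in> sets paths" for s
    unfolding A_def by measurable
  have A_iff: "\<omega> \<in> A s \<longleftrightarrow> (\<forall>C. \<exists>n. C < G n s \<omega>)" if "\<omega> \<in> space paths" for s \<omega>
    using that unfolding A_def by (auto intro: le_less_trans) (meson le_less_trans real_arch_simple)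
  have shift_space: "\<omega> \<in> space paths \<Longrightarrow> shift \<omega> \<in> space paths" for \<omega>
    by (rule measurable_space[OF shift_measurable])
  have A_shift: "AE \<omega> in paths. \<omega> \<in> A s \<longleftrightarrow> shift \<omega> \<in> A (\<not> s)" for s
    using R_bounded[of s] AE_space
  proof eventually_elim
    case (elim \<omega>)
    then obtain C where C: "\<And>n. R n s \<omega> \<le> C" by blast
    have "(\<forall>D. \<exists>n. D < G n s \<omega>) \<longleftrightarrow> (\<forall>D. \<exists>n. D < G n (\<not> s) (shift \<omega>))"
    proof (intro iffI allI)
      fix D assume *: "\<forall>D. \<exists>n. D < G n s \<omega>"
      then obtain n where n: "max (max 0 C) (V s (\<omega> 0) + D) < G n s \<omega>" by blast
      then obtain k where "n = Suc k" by (cases n) (auto simp: G_0)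
      with n C[of k] have "D < G k (\<not> s) (shift \<omega>)" unfolding G_Suc by (auto simp: G_Suc max_def split: if_splits)
      then show "\<exists>n. D < G n (\<not> s) (shift \<omega>)" ..
    next
      fix D assume *: "\<forall>D. \<exists>n. D < G n (\<not> s) (shift \<omega>)"
      then obtain n where "D - V s (\<omega> 0) < G n (\<not> s) (shift \<omega>)" by blast
      then have "D < G (Suc n) s \<omega>" unfolding G_Suc by linarith
      then show "\<exists>n. D < G n s \<omega>" ..
    qed
    then show ?case using elim shift_space by (simp add: A_iff)
  qed
  have A_prob: "measure paths (A s) = measure paths (A (\<not> s))" for s
  proof -
    have "measure paths (A s) = (\<integral>\<omega>. indicator (A s) \<omega> \<partial>paths)"
      by simp
    also have "\<dots> = (\<integral>\<omega>. indicator (A (\<not> s)) (shift \<omega>) \<partial>paths)"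
      by (rule integral_cong_AE) (use A_shift[of s] in \<open>auto simp: indicator_def elim: eventually_mono\<close>)
    also have "\<dots> = (\<integral>\<omega>. indicator (A (\<not> s)) \<omega> \<partial>paths)"
      by (rule integral_shift) (simp add: P.emeasure_eq_measure)
    also have "\<dots> = measure paths (A (\<not> s))"
      by simp
    finally show ?thesis .
  qed
  define p where "p = measure paths (A True)"
  have p: "measure paths (A s) = p" for s
    using A_prob[of False] by (cases s) (auto simp: p_def)

  \<comment> \<open>The mean change of \<open>G\<close> in one step, restricted to the event; the step is undone by the shift.\<close>
  define I where "I n s = (\<integral>\<omega>. indicator (A s) \<omega> * (G (Suc n) s \<omega> - G n (\<not> s) (shift \<omega>)) \<partial>paths)" for n s
  have int_A: "integrable paths (\<lambda>\<omega>. indicator (A s) \<omega> * f \<omega>)" if "integrable paths f" for s and f :: "_ \<Rightarrow> real"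
    using integrable_mult_indicator[OF A_sets that, of s] by simp
  have I_eq: "I n s = (\<integral>\<omega>. indicator (A s) \<omega> * G (Suc n) s \<omega> \<partial>paths) -
      (\<integral>\<omega>. indicator (A (\<not> s)) \<omega> * G n (\<not> s) \<omega> \<partial>paths)" for n s
  proof -
    have "I n s = (\<integral>\<omega>. indicator (A s) \<omega> * G (Suc n) s \<omega> \<partial>paths) -
        (\<integral>\<omega>. indicator (A s) \<omega> * G n (\<not> s) (shift \<omega>) \<partial>paths)"
      unfolding I_def right_diff_distrib
      by (intro Bochner_Integration.integral_diff int_A G_integrable integrable_shift)
    also have "(\<integral>\<omega>. indicator (A s) \<omega> * G n (\<not> s) (shift \<omega>) \<partial>paths) =
        (\<integral>\<omega>. indicator (A (\<not> s)) (shift \<omega>) * G n (\<not> s) (shift \<omega>) \<partial>paths)"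
      by (rule integral_cong_AE) (use A_shift[of s] in \<open>auto simp: indicator_def elim: eventually_mono\<close>)
    also have "\<dots> = (\<integral>\<omega>. indicator (A (\<not> s)) \<omega> * G n (\<not> s) \<omega> \<partial>paths)"
      by (rule integral_shift) (intro int_A G_integrable)
    finally show ?thesis .
  qed
  have I_nonneg: "0 \<le> I n True + I n False" for n
  proof -
    have "(\<integral>\<omega>. indicator (A s) \<omega> * G n s \<omega> \<partial>paths) \<le> (\<integral>\<omega>. indicator (A s) \<omega> * G (Suc n) s \<omega> \<partial>paths)" for s
      by (intro integral_mono int_A G_integrable mult_left_mono G_mono) simp
    from this[of True] this[of False] show ?thesis
      unfolding I_eq by simp
  qed
  have I_tendsto: "(\<lambda>n. I n s) \<longlonglongrightarrow> (\<integral>x. V s x \<partial>M) * p" for s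
  proof -
    have "(\<lambda>n. I n s) \<longlonglongrightarrow> (\<integral>\<omega>. indicator (A s) \<omega> * V s (\<omega> 0) \<partial>paths)"
      unfolding I_def
    proof (rule integral_dominated_convergence)
      show "integrable paths (\<lambda>\<omega>. \<bar>H s (\<omega> 0)\<bar> + \<bar>V s (\<omega> 0)\<bar>)"
        by (intro Bochner_Integration.integrable_add integrable_abs H0 V0)
      show "AE \<omega> in paths. norm (indicator (A s) \<omega> * (G (Suc n) s \<omega> - G n (\<not> s) (shift \<omega>)))
          \<le> \<bar>H s (\<omega> 0)\<bar> + \<bar>V s (\<omega> 0)\<bar>" for n
      proof (rule AE_I2)
        fix \<omega>
        have "\<bar>G (Suc n) s \<omega> - G n (\<not> s) (shift \<omega>)\<bar> \<le> \<bar>H s (\<omega> 0)\<bar> + \<bar>V s (\<omega> 0)\<bar>"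
          using R_le[of n s \<omega>] unfolding G_Suc by linarith
        then show "norm (indicator (A s) \<omega> * (G (Suc n) s \<omega> - G n (\<not> s) (shift \<omega>)))
          \<le> \<bar>H s (\<omega> 0)\<bar> + \<bar>V s (\<omega> 0)\<bar>"
          by (simp add: indicator_def)
      qed
      show "AE \<omega> in paths. (\<lambda>n. indicator (A s) \<omega> * (G (Suc n) s \<omega> - G n (\<not> s) (shift \<omega>)))
          \<longlonglongrightarrow> indicator (A s) \<omega> * V s (\<omega> 0)"
        using R_bounded[of s] A_shift[of s] AE_space
      proof eventually_elim
        case (elim \<omega>)
        show ?case
        proof (cases "\<omega> \<in> A s")
          case True
          obtain C where C: "\<And>n. R n s \<omega> \<le> C" using elim by blast
          have "shift \<omega> \<in> A (\<not> s)" using True elim by blast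
          then obtain N where N: "C - V s (\<omega> 0) < G N (\<not> s) (shift \<omega>)"
            using elim shift_space A_iff[of "shift \<omega>" "\<not> s"] by blast
          have "G (Suc n) s \<omega> - G n (\<not> s) (shift \<omega>) = V s (\<omega> 0)" if "N \<le> n" for n
            using N C[of n] G_le[OF that, of "\<not> s" "shift \<omega>"] unfolding G_Suc by linarith
          then have "eventually (\<lambda>n. G (Suc n) s \<omega> - G n (\<not> s) (shift \<omega>) = V s (\<omega> 0)) sequentially"
            unfolding eventually_sequentially by blast
          then have "(\<lambda>n. G (Suc n) s \<omega> - G n (\<not> s) (shift \<omega>)) \<longlonglongrightarrow> V s (\<omega> 0)"
            by (rule tendsto_eventually)
          then show ?thesis by (intro tendsto_mult tendsto_const)
        qed simp
      qed
    qed measurable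
    also have "(\<integral>\<omega>. indicator (A s) \<omega> * V s (\<omega> 0) \<partial>paths) =
        (\<integral>\<omega>. V s (\<omega> 0) * indicator (A (\<not> s)) (shift \<omega>) \<partial>paths)"
      by (rule integral_cong_AE) (use A_shift[of s] in \<open>auto simp: indicator_def elim: eventually_mono\<close>)
    also have "\<dots> = (\<integral>x. V s x \<partial>M) * p"
      by (subst integral_coordinate_times_shift) (auto simp: V p)
    finally show ?thesis .
  qed
  have "0 \<le> (\<integral>x. V True x \<partial>M) * p + (\<integral>x. V False x \<partial>M) * p"
    by (rule LIMSEQ_le_const[OF tendsto_add[OF I_tendsto I_tendsto]]) (use I_nonneg in blast)
  then have "0 \<le> ((\<integral>x. V True x \<partial>M) + (\<integral>x. V False x \<partial>M)) * p"
    by (simp add: distrib_right)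
  then have "p \<le> 0"
    using drift by (auto simp: zero_le_mult_iff)
  then have "measure paths (A s) = 0"
    using p[of s] by (simp add: p_def measure_le_0_iff)
  then have "AE \<omega> in paths. \<omega> \<notin> A s"
    by (intro AE_not_in) (auto simp: null_sets_def P.emeasure_eq_measure)
  then show ?thesis
    using AE_space by eventually_elim (auto simp: A_iff not_less)
qed

lemma ladder_measurable:
  assumes [measurable]: "\<And>s. U s \<in> borel_measurable M"
  shows "(\<lambda>\<omega>. ladder1 (alternating U s \<omega>) n) \<in> borel_measurable paths"
proof (induction n arbitrary: s)
  case (Suc n)
  note [measurable] = Suc
  have "(\<lambda>\<omega>. ladder1 (alternating U (\<not> s) (shift \<omega>)) n) \<in> borel_measurable paths"
    by (rule measurable_compose[OF shift_measurable Suc])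
  then show ?case by (simp add: alternating_0 alternating_Suc)
qed simp

lemma ladder_Suc:
  "ladder1 (alternating U s \<omega>) (Suc n) =
     max 0 (U s (\<omega> 0) + ladder1 (alternating U (\<not> s) (shift \<omega>)) n)"
  "ladder2 (alternating U s \<omega>) (alternating V s \<omega>) (Suc n) =
     max (ladder1 (alternating U s \<omega>) (Suc n))
       (V s (\<omega> 0) + ladder2 (alternating U (\<not> s) (shift \<omega>)) (alternating V (\<not> s) (shift \<omega>)) n)"
  by (simp_all add: alternating_0 alternating_Suc)

text \<open>With \<open>R = 0\<close> the maximum of the \<open>U\<close>-walk is finite; this bounds the term \<open>R\<close> in the recursion of \<^const>\<open>ladder2\<close>.\<close>

lemma ladders_bounded:
  assumes U: "\<And>s. integrable M (U s)" and V: "\<And>s. integrable M (V s)"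
    and "(\<integral>x. U True x \<partial>M) + (\<integral>x. U False x \<partial>M) < 0"
    and "(\<integral>x. V True x \<partial>M) + (\<integral>x. V False x \<partial>M) < 0"
  shows "AE \<omega> in paths. \<exists>C. \<forall>n. ladder2 (alternating U s \<omega>) (alternating V s \<omega>) n \<le> C"
proof -
  have 1: "AE \<omega> in paths. \<exists>C. \<forall>n. ladder1 (alternating U s \<omega>) n \<le> C" for s
    by (rule bounded_by_negative_drift[where V=U and R="\<lambda>_ _ _. 0" and H="\<lambda>_ _. 0"])
       (auto simp: assms ladder_Suc ladder1_nonneg simp del: ladder1.simps(2))
  have *: "ladder1 (alternating U s \<omega>) (Suc n) \<le>
      \<bar>U s (\<omega> 0)\<bar> + ladder2 (alternating U (\<not> s) (shift \<omega>)) (alternating V (\<not> s) (shift \<omega>)) n" for s \<omega> n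
    using ladder1_le_ladder2[of "alternating U (\<not> s) (shift \<omega>)" n "alternating V (\<not> s) (shift \<omega>)"]
      ladder1_nonneg[of "alternating U (\<not> s) (shift \<omega>)" n]
    unfolding ladder_Suc(1) by linarith
  show ?thesis
  proof (rule bounded_by_negative_drift[where V=V and R="\<lambda>n s \<omega>. ladder1 (alternating U s \<omega>) (Suc n)"
        and H="\<lambda>s x. \<bar>U s x\<bar>"])
    show "AE \<omega> in paths. \<exists>C. \<forall>n. ladder1 (alternating U s \<omega>) (Suc n) \<le> C" for s
      using 1[of s] by eventually_elim blast
    show "(\<lambda>\<omega>. ladder1 (alternating U s \<omega>) (Suc n)) \<in> borel_measurable paths" for n s
      by (rule ladder_measurable) (rule borel_measurable_integrable[OF U])
  qed (rule V integrable_abs[OF U] ladder2.simps(1) ladder_Suc(2) ladder1_nonneg ladder1_mono * assms)+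
qed

end

context killed_walk
begin

text \<open>The pair survives as soon as both coordinates exceed the almost surely finite bound on the ladders.
  The dominating increments \<open>U'\<close> and \<open>V'\<close> carry the integrability.\<close>

lemma survival_tends_to_1:
  assumes int: "\<And>s. integrable M (U' s)" "\<And>s. integrable M (V' s)"
    and drift: "(\<integral>x. U' True x \<partial>M) + (\<integral>x. U' False x \<partial>M) < 0"
      "(\<integral>x. V' True x \<partial>M) + (\<integral>x. V' False x \<partial>M) < 0"
    and le: "\<And>s x. U s x \<le> U' s x" "\<And>s x. V s x \<le> V' s x"
    and e: "e < 1"
  shows "\<exists>c. \<forall>s u v. ereal c \<le> u \<longrightarrow> ereal c \<le> v \<longrightarrow> e \<le> survival s (u, v)"
proof -
  interpret P: prob_space paths by (rule prob_space_paths)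
  note [measurable] = borel_measurable_integrable[OF int(1)] borel_measurable_integrable[OF int(2)]
  let ?G = "\<lambda>s \<omega>. ladder2 (alternating U' s \<omega>) (alternating V' s \<omega>)"
  have meas [measurable]: "(\<lambda>\<omega>. ?G s \<omega> n) \<in> borel_measurable paths" for s n
  proof (induction n arbitrary: s)
    case (Suc n)
    have [measurable]: "(\<lambda>\<omega>. ?G (\<not> s) (shift \<omega>) n) \<in> borel_measurable paths"
      by (rule measurable_compose[OF shift_measurable Suc])
    note [measurable] = ladder_measurable[of U']
    show ?case unfolding ladder_Suc(2) by measurable
  qed simp
  have "\<exists>c. \<forall>u v. ereal c \<le> u \<longrightarrow> ereal c \<le> v \<longrightarrow> e \<le> survival s (u, v)" for s
  proof -
    let ?B = "\<lambda>C. {\<omega> \<in> space paths. \<forall>n. ?G s \<omega> n \<le> real C}"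
    have "incseq ?B"
      by (rule incseq_SucI) (auto intro: order_trans)
    moreover have "range ?B \<subseteq> sets paths" by auto
    ultimately have "(\<lambda>C. emeasure paths (?B C)) \<longlonglongrightarrow> emeasure paths (\<Union>C. ?B C)"
      by (intro Lim_emeasure_incseq)
    moreover have "emeasure paths (\<Union>C. ?B C) = 1"
    proof (rule P.emeasure_eq_1_AE)
      show "AE \<omega> in paths. \<omega> \<in> (\<Union>C. ?B C)"
        using ladders_bounded[where U=U' and V=V' and s=s, OF int drift] AE_space
        by eventually_elim (auto, meson order_trans real_arch_simple)
    qed auto
    ultimately have "eventually (\<lambda>C. e < emeasure paths (?B C)) sequentially"
      using e by (simp add: order_tendstoD)
    then obtain C :: nat where C: "e < emeasure paths (?B C)"
      by (auto simp: eventually_sequentially)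
    have "e \<le> survival s (u, v)" if "ereal (real C) \<le> u" "ereal (real C) \<le> v" for u v
    proof -
      have "e \<le> emeasure paths (?B C)" using C by simp
      also have "\<dots> \<le> survival s (u, v)"
        unfolding survival_eq_paths
      proof (rule emeasure_mono)
        show "?B C \<subseteq> {\<omega> \<in> space paths. \<forall>n. survives (alternating U s \<omega>) (alternating V s \<omega>) n (u, v)}"
        proof
          fix \<omega> assume \<omega>: "\<omega> \<in> ?B C"
          have "survives (alternating U s \<omega>) (alternating V s \<omega>) n (u, v)" for n
          proof (rule survives_if_ladders_le)
            have G: "ereal (?G s \<omega> n) \<le> ereal (real C)"
              using \<omega> by simp
            then show "ereal (?G s \<omega> n) \<le> v"
              using that(2) by (rule order_trans)
            have "ereal (ladder1 (alternating U' s \<omega>) n) \<le> ereal (?G s \<omega> n)"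
              by (simp add: ladder1_le_ladder2)
            also note G
            also note that(1)
            finally show "ereal (ladder1 (alternating U' s \<omega>) n) \<le> u" .
          qed (simp_all add: alternating_def le)
          then show "\<omega> \<in> {\<omega> \<in> space paths. \<forall>n. survives (alternating U s \<omega>) (alternating V s \<omega>) n (u, v)}"
            using \<omega> by simp
        qed
      qed measurable
      finally show ?thesis .
    qed
    then show ?thesis by blast
  qed
  then obtain c where c: "\<And>s u v. ereal (c s) \<le> u \<Longrightarrow> ereal (c s) \<le> v \<Longrightarrow> e \<le> survival s (u, v)"
    by metis
  have "ereal (c s) \<le> w" if "ereal (max (c True) (c False)) \<le> w" for s w
    using that by (cases s) auto
  then show ?thesis
    using c by blast
qed

end

section \<open>The conditional law of the process\<close>

definition label :: "bool \<Rightarrow> nat" where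
  "label s = (if s then 1 else 2)"

lemma label_not: "label (\<not> s) = 3 - label s"
  by (simp add: label_def)

lemma label_in: "label s \<in> {1, 2}"
  by (simp add: label_def)

lemma all_label: "(\<forall>i\<in>{1, 2}. P i) \<longleftrightarrow> (\<forall>s. P (label s))"
  by (auto simp: label_def split: if_splits)

lemma (in prob_space) indep_rvD:
  assumes "indep_rv M N1 X1 N2 X2" "A1 \<in> sets N1" "A2 \<in> sets N2"
  shows "prob {\<omega> \<in> space M. X1 \<omega> \<in> A1 \<and> X2 \<omega> \<in> A2} =
    prob {\<omega> \<in> space M. X1 \<omega> \<in> A1} * prob {\<omega> \<in> space M. X2 \<omega> \<in> A2}"
proof -
  have "prob ((X1 -` A1 \<inter> space M) \<inter> (X2 -` A2 \<inter> space M)) =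
      prob (X1 -` A1 \<inter> space M) * prob (X2 -` A2 \<inter> space M)"
    using assms by (intro indep_setD) (auto simp: indep_rv_def)
  moreover have "X1 -` A1 \<inter> space M = {\<omega> \<in> space M. X1 \<omega> \<in> A1}"
    "X2 -` A2 \<inter> space M = {\<omega> \<in> space M. X2 \<omega> \<in> A2}"
    "(X1 -` A1 \<inter> space M) \<inter> (X2 -` A2 \<inter> space M) = {\<omega> \<in> space M. X1 \<omega> \<in> A1 \<and> X2 \<omega> \<in> A2}"
    by auto
  ultimately show ?thesis by simp
qed

lemma (in prob_space) prob_eq_of_distr_eq:
  assumes "distr M borel f = distr M borel g" "f \<in> borel_measurable M" "g \<in> borel_measurable M"
    and "A \<in> sets borel"
  shows "prob {\<omega> \<in> space M. f \<omega> \<in> A} = prob {\<omega> \<in> space M. g \<omega> \<in> A}"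
proof -
  have "measure (distr M borel f) A = measure (distr M borel g) A"
    using assms(1) by simp
  then show ?thesis
    using assms(2-4) by (simp add: measure_distr vimage_def Int_def conj_commute)
qed

lemma prod_lessThan_double:
  fixes f :: "nat \<Rightarrow> 'b :: comm_monoid_mult"
  shows "(\<Prod>m<2 * L. f m) = (\<Prod>h<L. f (2 * h) * f (2 * h + 1))"
  by (induction L) (simp_all add: mult.assoc)

locale alternate_renewal = prob_space M for M :: "'a measure" +
  fixes X :: "nat \<Rightarrow> 'a \<Rightarrow> real" and Y Z :: "'a \<Rightarrow> real"
    and B :: "'a \<Rightarrow> nat"
    and Xs :: "nat \<Rightarrow> nat \<Rightarrow> 'a \<Rightarrow> real" and Ys Zs :: "nat \<Rightarrow> 'a \<Rightarrow> real"
  assumes indep_XYZ: "indep_vars (\<lambda>_. borel) (\<lambda>j. [X 1, X 2, Y, Z] ! j) {..<4}"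
    and B_prob: "\<And>i. i \<in> {1, 2} \<Longrightarrow> \<P>(\<omega> in M. B \<omega> = i) = 1 / 2"
    and Xs_indep: "indep_vars (\<lambda>_. borel) (\<lambda>k \<omega>. (Xs 1 k \<omega>, Xs 2 k \<omega>)) UNIV"
    and Xs_distr: "\<And>k. distr M borel (\<lambda>\<omega>. (Xs 1 k \<omega>, Xs 2 k \<omega>)) =
        distr M borel (\<lambda>\<omega>. (X 1 \<omega>, X 2 \<omega>))"
    and B_indep: "indep_rv M (count_space UNIV) B
        (PiM UNIV (\<lambda>_. borel)) (\<lambda>\<omega> k. (Xs 1 k \<omega>, Xs 2 k \<omega>))"
    and YZs_indep: "indep_vars (\<lambda>_. borel) (\<lambda>k \<omega>. (Ys k \<omega>, Zs k \<omega>)) {1..}"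
    and YZs_distr: "\<And>k. k \<ge> 1 \<Longrightarrow> distr M borel (\<lambda>\<omega>. (Ys k \<omega>, Zs k \<omega>)) =
        distr M borel (\<lambda>\<omega>. (Y \<omega>, Z \<omega>))"
    and YZs_XB_indep: "indep_rv M
        (PiM {1..} (\<lambda>_. borel)) (\<lambda>\<omega>. \<lambda>k\<in>{1..}. (Ys k \<omega>, Zs k \<omega>))
        (PiM UNIV (\<lambda>_. borel) \<Otimes>\<^sub>M count_space UNIV) (\<lambda>\<omega>. (\<lambda>k. ar_process B Xs k \<omega>, B \<omega>))"
begin

definition U :: "bool \<Rightarrow> 'a \<Rightarrow> real" where
  "U s \<omega> = Y \<omega> - X (label s) \<omega>"

definition V :: "bool \<Rightarrow> 'a \<Rightarrow> real" where
  "V s \<omega> = Z \<omega> - X (label s) \<omega>"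

lemma X_measurable [measurable]: "X (label s) \<in> borel_measurable M"
  and Y_measurable [measurable]: "Y \<in> borel_measurable M"
  and Z_measurable [measurable]: "Z \<in> borel_measurable M"
proof -
  have *: "[X 1, X 2, Y, Z] ! j \<in> borel_measurable M" if "j < 4" for j
    using indep_XYZ that by (auto simp: indep_vars_def)
  from *[of 0] *[of 1] *[of 2] *[of 3]
  show "X (label s) \<in> borel_measurable M" "Y \<in> borel_measurable M" "Z \<in> borel_measurable M"
    by (simp_all add: label_def)
qed

lemma X_index_measurable [measurable]: "i \<in> {1, 2} \<Longrightarrow> X i \<in> borel_measurable M"
  using X_measurable[of True] X_measurable[of False] by (auto simp: label_def)

sublocale killed_walk M U V
  by unfold_locales (simp_all add: U_def[abs_def] V_def[abs_def])

lemma Xs_measurable: "(\<lambda>\<omega>. (Xs 1 k \<omega>, Xs 2 k \<omega>)) \<in> borel_measurable M"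
  using Xs_indep by (simp add: indep_vars_def)

lemma YZs_measurable: "1 \<le> k \<Longrightarrow> (\<lambda>\<omega>. (Ys k \<omega>, Zs k \<omega>)) \<in> borel_measurable M"
  using YZs_indep by (simp add: indep_vars_def)

lemma ar_process_measurable: "(\<lambda>\<omega>. (\<lambda>k. ar_process B Xs k \<omega>, B \<omega>)) \<in>
    M \<rightarrow>\<^sub>M PiM UNIV (\<lambda>_. borel) \<Otimes>\<^sub>M count_space UNIV"
  using YZs_XB_indep by (simp add: indep_rv_def)

lemma ar_process_coordinate_measurable [measurable]: "ar_process B Xs k \<in> borel_measurable M"
  using measurable_compose[OF measurable_compose[OF ar_process_measurable measurable_fst]
      measurable_component_singleton[of k UNIV]] by simp

lemma B_measurable [measurable]: "B \<in> M \<rightarrow>\<^sub>M count_space UNIV"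
  using measurable_compose[OF ar_process_measurable measurable_snd] by simp

lemma prob_X_pair:
  assumes i: "i \<in> {1, 2}" and A: "A \<in> sets borel" "A' \<in> sets borel"
  shows "prob {\<omega> \<in> space M. X i \<omega> \<in> A \<and> X (3 - i) \<omega> \<in> A'} =
    prob {\<omega> \<in> space M. X i \<omega> \<in> A} * prob {\<omega> \<in> space M. X (3 - i) \<omega> \<in> A'}"
proof -
  let ?W = "\<lambda>j. [X 1, X 2, Y, Z] ! j"
  have "prob (\<Inter>j\<in>{0, 1}. ?W j -` (if j = i - 1 then A else A') \<inter> space M) =
      (\<Prod>j\<in>{0, 1}. prob (?W j -` (if j = i - 1 then A else A') \<inter> space M))"
    using A by (intro indep_varsD[OF indep_XYZ]) auto
  then show ?thesis
    using i by (auto simp: vimage_def Int_def conj_commute conj_left_commute mult.commute)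
qed

text \<open>The joint law of \<open>Y\<close> and \<open>Z\<close> is compared on arbitrary Borel sets of the plane, so independence
  of \<open>X\<close> from the vector is what is required.\<close>

lemma prob_X_YZ:
  assumes A: "A \<in> sets borel" "C \<in> sets borel"
  shows "prob {\<omega> \<in> space M. X (label s) \<omega> \<in> A \<and> (Y \<omega>, Z \<omega>) \<in> C} =
    prob {\<omega> \<in> space M. X (label s) \<omega> \<in> A} * prob {\<omega> \<in> space M. (Y \<omega>, Z \<omega>) \<in> C}"
proof -
  let ?W = "\<lambda>j. [X 1, X 2, Y, Z] ! j" and ?j = "label s - 1"
  have "indep_var (PiM {?j} (\<lambda>_. borel)) (\<lambda>\<omega>. restrict (\<lambda>j. ?W j \<omega>) {?j})
      (PiM {2, 3} (\<lambda>_. borel)) (\<lambda>\<omega>. restrict (\<lambda>j. ?W j \<omega>) {2, 3})"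
    by (rule indep_var_restrict[OF indep_XYZ]) (auto simp: label_def)
  then have "prob ((\<lambda>\<omega>. (restrict (\<lambda>j. ?W j \<omega>) {?j}, restrict (\<lambda>j. ?W j \<omega>) {2, 3})) -`
        ({f \<in> space (PiM {?j} (\<lambda>_. borel)). f ?j \<in> A} \<times>
         {f \<in> space (PiM {2, 3} (\<lambda>_. borel)). (f 2, f 3) \<in> C}) \<inter> space M) =
      prob ((\<lambda>\<omega>. restrict (\<lambda>j. ?W j \<omega>) {?j}) -` {f \<in> space (PiM {?j} (\<lambda>_. borel)). f ?j \<in> A} \<inter> space M) *
      prob ((\<lambda>\<omega>. restrict (\<lambda>j. ?W j \<omega>) {2, 3}) -`
         {f \<in> space (PiM {2, 3} (\<lambda>_. borel)). (f 2, f 3) \<in> C} \<inter> space M)"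
  proof (rule indep_varD)
    note [measurable] = A
    have [measurable]: "(\<lambda>f. (f 2, f 3)) \<in> PiM {2, 3} (\<lambda>_. borel) \<rightarrow>\<^sub>M (borel :: (real \<times> real) measure)"
      by (intro borel_measurable_Pair measurable_component_singleton) auto
    show "{f \<in> space (PiM {?j} (\<lambda>_. borel)). f ?j \<in> A} \<in> sets (PiM {?j} (\<lambda>_. borel))"
      "{f \<in> space (PiM {2, 3} (\<lambda>_. borel)). (f 2, f 3) \<in> C} \<in> sets (PiM {2, 3} (\<lambda>_. borel :: real measure))"
      by measurable
  qed
  moreover have "?W ?j = X (label s)" "?W 2 = Y" "?W 3 = Z"
    by (simp_all add: label_def numeral_3_eq_3)
  ultimately show ?thesis
    by (simp add: vimage_def space_PiM Int_def conj_commute)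
qed

text \<open>Steps \<open>2 h\<close> and \<open>2 h + 1\<close> use the two coordinates of the same copy \<open>h\<close>. Different copies are independent, and the two
  coordinates of one copy are independent since \<open>X\<^sup>(\<^sup>1\<^sup>)\<close> and \<open>X\<^sup>(\<^sup>2\<^sup>)\<close> are.\<close>

lemma prob_alternating_copies:
  assumes i: "i \<in> {1, 2}" and E: "\<And>m. E m \<in> sets borel" and L: "0 < L"
  shows "prob {\<omega> \<in> space M. \<forall>m<2 * L. Xs (if even m then i else 3 - i) (m div 2) \<omega> \<in> E m} =
    (\<Prod>m<2 * L. prob {\<omega> \<in> space M. X (if even m then i else 3 - i) \<omega> \<in> E m})"
proof -
  define R where "R h = {p :: real \<times> real. (if i = 1 then fst p else snd p) \<in> E (2 * h) \<and>
      (if i = 1 then snd p else fst p) \<in> E (2 * h + 1)}" for h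
  have R [measurable]: "R h \<in> sets borel" for h
  proof -
    note [measurable] = E
    have "Measurable.pred (borel \<Otimes>\<^sub>M borel) (\<lambda>p. p \<in> R h)"
      unfolding R_def by (cases "i = 1") simp_all
    then show ?thesis
      unfolding borel_prod by (simp add: pred_def)
  qed
  have split: "(\<forall>m<2 * L. P m) \<longleftrightarrow> (\<forall>h<L. P (2 * h) \<and> P (2 * h + 1))" for P
  proof (intro iffI allI impI)
    fix m assume *: "\<forall>h<L. P (2 * h) \<and> P (2 * h + 1)" "m < 2 * L"
    then show "P m"
      using *(1)[rule_format, of "m div 2"] by (cases "even m") auto
  qed auto
  have "{\<omega> \<in> space M. \<forall>m<2 * L. Xs (if even m then i else 3 - i) (m div 2) \<omega> \<in> E m} =
      (\<Inter>h\<in>{..<L}. (\<lambda>\<omega>. (Xs 1 h \<omega>, Xs 2 h \<omega>)) -` R h \<inter> space M)"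
    unfolding split using i L by (auto simp: R_def)
  also have "prob \<dots> = (\<Prod>h<L. prob ((\<lambda>\<omega>. (Xs 1 h \<omega>, Xs 2 h \<omega>)) -` R h \<inter> space M))"
    using L by (intro indep_varsD[OF Xs_indep]) auto
  also have "\<dots> = (\<Prod>h<L. prob {\<omega> \<in> space M. (X 1 \<omega>, X 2 \<omega>) \<in> R h})"
  proof (rule prod.cong[OF refl])
    fix h
    have "prob {\<omega> \<in> space M. (Xs 1 h \<omega>, Xs 2 h \<omega>) \<in> R h} = prob {\<omega> \<in> space M. (X 1 \<omega>, X 2 \<omega>) \<in> R h}"
      by (intro prob_eq_of_distr_eq Xs_distr Xs_measurable borel_measurable_Pair) simp_all
    then show "prob ((\<lambda>\<omega>. (Xs 1 h \<omega>, Xs 2 h \<omega>)) -` R h \<inter> space M) =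
        prob {\<omega> \<in> space M. (X 1 \<omega>, X 2 \<omega>) \<in> R h}"
      by (simp add: vimage_def Int_def conj_commute)
  qed
  also have "\<dots> = (\<Prod>h<L. prob {\<omega> \<in> space M. X i \<omega> \<in> E (2 * h) \<and> X (3 - i) \<omega> \<in> E (2 * h + 1)})"
    using i by (intro prod.cong refl arg_cong[where f=prob]) (auto simp: R_def)
  also have "\<dots> = (\<Prod>h<L. prob {\<omega> \<in> space M. X i \<omega> \<in> E (2 * h)} *
      prob {\<omega> \<in> space M. X (3 - i) \<omega> \<in> E (2 * h + 1)})"
    by (intro prod.cong refl prob_X_pair i E)
  also have "\<dots> = (\<Prod>m<2 * L. prob {\<omega> \<in> space M. X (if even m then i else 3 - i) \<omega> \<in> E m})"
    unfolding prod_lessThan_double by (intro prod.cong refl) simp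
  finally show ?thesis .
qed

text \<open>The walks start at index 1, whereas the alternating copies start at index 0; the set \<open>UNIV\<close> is put at index 0.
  The number \<open>N\<close> of steps is odd so that the copies up to index \<open>N\<close> come in complete pairs.\<close>

lemma prob_steps_given_B:
  assumes i: "label s = 3 - i" "i \<in> {1, 2}"
    and D: "\<And>k. D k \<in> sets borel" and C: "\<And>k. C k \<in> sets borel"
    and N: "N = Suc (2 * L)"
  shows "prob {\<omega> \<in> space M. B \<omega> = i \<and> (\<forall>k<N. ar_process B Xs (Suc k) \<omega> \<in> D k \<and>
      (Ys (Suc k) \<omega>, Zs (Suc k) \<omega>) \<in> C k)} =
    1 / 2 * (\<Prod>k<N. prob {\<omega> \<in> space M. X (label (turn s k)) \<omega> \<in> D k \<and> (Y \<omega>, Z \<omega>) \<in> C k})"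
proof -
  define E where "E m = (case m of 0 \<Rightarrow> UNIV | Suc k \<Rightarrow> D k)" for m
  have E: "E m \<in> sets borel" for m
    by (cases m) (auto simp: E_def D)
  let ?XB = "\<lambda>\<omega>. (\<lambda>k. ar_process B Xs k \<omega>, B \<omega>)" and ?YZ = "\<lambda>\<omega>. \<lambda>k\<in>{1..}. (Ys k \<omega>, Zs k \<omega>)"
  define S where "S = {p \<in> space (PiM UNIV (\<lambda>_. borel) \<Otimes>\<^sub>M count_space UNIV).
      snd p = i \<and> (\<forall>k<N. (fst p (Suc k) :: real) \<in> D k)}"
  have S: "S \<in> sets (PiM UNIV (\<lambda>_. borel) \<Otimes>\<^sub>M count_space UNIV)"
  proof -
    note [measurable] = D
    show ?thesis unfolding S_def by measurable
  qed
  define T where "T = {f \<in> space (PiM {1..} (\<lambda>_. borel)). \<forall>k<N. (f (Suc k) :: real \<times> real) \<in> C k}"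
  have T: "T \<in> sets (PiM {1..} (\<lambda>_. borel))"
  proof -
    note [measurable] = C
    show ?thesis unfolding T_def by measurable
  qed
  have XB: "?XB \<omega> \<in> S \<longleftrightarrow> B \<omega> = i \<and> (\<forall>k<N. ar_process B Xs (Suc k) \<omega> \<in> D k)" for \<omega>
    by (auto simp: S_def space_pair_measure space_PiM)
  have YZ: "?YZ \<omega> \<in> T \<longleftrightarrow> (\<forall>k<N. (Ys (Suc k) \<omega>, Zs (Suc k) \<omega>) \<in> C k)" for \<omega>
    by (auto simp: T_def space_PiM)
  have "prob {\<omega> \<in> space M. B \<omega> = i \<and> (\<forall>k<N. ar_process B Xs (Suc k) \<omega> \<in> D k \<and>
      (Ys (Suc k) \<omega>, Zs (Suc k) \<omega>) \<in> C k)} = prob {\<omega> \<in> space M. ?YZ \<omega> \<in> T \<and> ?XB \<omega> \<in> S}"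
    unfolding XB YZ by (intro arg_cong[where f=prob]) auto
  also have "\<dots> = prob {\<omega> \<in> space M. ?YZ \<omega> \<in> T} * prob {\<omega> \<in> space M. ?XB \<omega> \<in> S}"
    by (rule indep_rvD[OF YZs_XB_indep T S])
  also have "prob {\<omega> \<in> space M. ?YZ \<omega> \<in> T} = (\<Prod>k<N. prob {\<omega> \<in> space M. (Y \<omega>, Z \<omega>) \<in> C k})"
  proof -
    have "{\<omega> \<in> space M. ?YZ \<omega> \<in> T} =
        (\<Inter>k\<in>Suc ` {..<N}. (\<lambda>\<omega>. (Ys k \<omega>, Zs k \<omega>)) -` C (k - 1) \<inter> space M)"
      unfolding YZ using N by auto
    also have "prob \<dots> = (\<Prod>k\<in>Suc ` {..<N}. prob ((\<lambda>\<omega>. (Ys k \<omega>, Zs k \<omega>)) -` C (k - 1) \<inter> space M))"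
      using C N by (intro indep_varsD[OF YZs_indep]) auto
    also have "\<dots> = (\<Prod>k<N. prob {\<omega> \<in> space M. (Ys (Suc k) \<omega>, Zs (Suc k) \<omega>) \<in> C k})"
      by (subst prod.reindex) (auto simp: vimage_def Int_def conj_commute)
    also have "\<dots> = (\<Prod>k<N. prob {\<omega> \<in> space M. (Y \<omega>, Z \<omega>) \<in> C k})"
      by (intro prod.cong refl prob_eq_of_distr_eq YZs_distr YZs_measurable borel_measurable_Pair C) simp_all
    finally show ?thesis .
  qed
  also have "prob {\<omega> \<in> space M. ?XB \<omega> \<in> S} = 1 / 2 * (\<Prod>k<N. prob {\<omega> \<in> space M. X (label (turn s k)) \<omega> \<in> D k})"
  proof -
    define F where "F = {f \<in> space (PiM UNIV (\<lambda>_. borel)).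
        \<forall>m<2 * Suc L. 
        (if even m = (i = 1) then fst (f (m div 2)) else snd (f (m div 2) :: real \<times> real)) \<in> E m}"
    have F: "F \<in> sets (PiM UNIV (\<lambda>_. borel))"
    proof -
      note [measurable] = E
      have [measurable]: "(fst :: real \<times> real \<Rightarrow> real) \<in> borel_measurable borel" "(snd :: real \<times> real \<Rightarrow> real) \<in> borel_measurable borel"
        by (intro borel_measurable_continuous_onI continuous_intros)+
      show ?thesis unfolding F_def by measurable
    qed
    have N': "Suc N = 2 * Suc L" using N by simp
    have F_iff: "(\<lambda>k. (Xs 1 k \<omega>, Xs 2 k \<omega>)) \<in> F \<longleftrightarrow>
        (\<forall>m<2 * Suc L. Xs (if even m then i else 3 - i) (m div 2) \<omega> \<in> E m)" for \<omega>
    proof -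
      have *: "Xs (if even m then i else 3 - i) h \<omega> = (if even m = (i = 1) then Xs 1 h \<omega> else Xs 2 h \<omega>)" for m h
        using i(2) by (cases "even m") auto
      show ?thesis
        unfolding F_def mem_Collect_eq * fst_conv snd_conv by (simp add: space_PiM)
    qed
    have steps: "(\<forall>k<N. Xs (if even (Suc k) then i else 3 - i) (Suc k div 2) \<omega> \<in> D k) \<longleftrightarrow>
        (\<lambda>k. (Xs 1 k \<omega>, Xs 2 k \<omega>)) \<in> F" for \<omega>
      unfolding F_iff N'[symmetric] All_less_Suc2 by (simp add: E_def)
    have "{\<omega> \<in> space M. ?XB \<omega> \<in> S} = {\<omega> \<in> space M. B \<omega> \<in> {i} \<and> (\<lambda>k. (Xs 1 k \<omega>, Xs 2 k \<omega>)) \<in> F}"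
    proof -
      have "ar_process B Xs (Suc k) \<omega> = Xs (if even (Suc k) then i else 3 - i) (Suc k div 2) \<omega>" if "B \<omega> = i" for k \<omega>
        using that by (simp add: ar_process_def)
      then show ?thesis
        unfolding XB steps[symmetric] by auto
    qed
    also have "prob \<dots> = prob {\<omega> \<in> space M. B \<omega> \<in> {i}} * prob {\<omega> \<in> space M. (\<lambda>k. (Xs 1 k \<omega>, Xs 2 k \<omega>)) \<in> F}"
      by (rule indep_rvD[OF B_indep _ F]) simp
    also have "prob {\<omega> \<in> space M. B \<omega> \<in> {i}} = 1 / 2"
      using B_prob[OF i(2)] by simp
    also have "prob {\<omega> \<in> space M. (\<lambda>k. (Xs 1 k \<omega>, Xs 2 k \<omega>)) \<in> F} =
        (\<Prod>m<Suc N. prob {\<omega> \<in> space M. X (if even m then i else 3 - i) \<omega> \<in> E m})"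
      unfolding F_iff N' by (rule prob_alternating_copies[OF i(2) E]) simp
    also have "\<dots> = (\<Prod>k<N. prob {\<omega> \<in> space M. X (if even (Suc k) then i else 3 - i) \<omega> \<in> D k})"
      unfolding prod.lessThan_Suc_shift by (simp add: E_def prob_space)
    also have "\<dots> = (\<Prod>k<N. prob {\<omega> \<in> space M. X (label (turn s k)) \<omega> \<in> D k})"
    proof (rule prod.cong[OF refl])
      fix k
      have "(if even (Suc k) then i else 3 - i) = label (turn s k)"
        using i by (auto simp: turn_def label_not)
      then show "prob {\<omega> \<in> space M. X (if even (Suc k) then i else 3 - i) \<omega> \<in> D k} =
          prob {\<omega> \<in> space M. X (label (turn s k)) \<omega> \<in> D k}" by simp
    qed
    finally show ?thesis .
  qed
  finally show ?thesis
    by (simp add: prob_X_YZ[OF D C] prod.distrib)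
qed

text \<open>The step \<open>k\<close> contributes two independent entries, the value of \<open>X\<close> and the pair \<open>(Y, Z)\<close>. Both are stored as
  points of the plane under separate indices, so that the law on the product space is determined by rectangles.\<close>

definition observed :: "'a \<Rightarrow> nat \<times> bool \<Rightarrow> real \<times> real" where
  "observed \<omega> = (\<lambda>(k, c). if c then (Ys (Suc k) \<omega>, Zs (Suc k) \<omega>) else (ar_process B Xs (Suc k) \<omega>, 0))"

definition canonical :: "bool \<Rightarrow> (nat \<Rightarrow> 'a) \<Rightarrow> nat \<times> bool \<Rightarrow> real \<times> real" where
  "canonical s \<omega> = (\<lambda>(k, c). if c then (Y (\<omega> k), Z (\<omega> k)) else (X (label (turn s k)) (\<omega> k), 0))"

lemma observed_measurable [measurable]: "observed \<in> M \<rightarrow>\<^sub>M PiM UNIV (\<lambda>_. borel)"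
  unfolding observed_def[abs_def]
proof (rule measurable_PiM_single')
  fix j :: "nat \<times> bool"
  show "(\<lambda>\<omega>. case j of (k, c) \<Rightarrow> if c then (Ys (Suc k) \<omega>, Zs (Suc k) \<omega>)
      else (ar_process B Xs (Suc k) \<omega>, 0)) \<in> borel_measurable M"
    by (cases j; cases "snd j") (auto intro!: YZs_measurable borel_measurable_Pair)
qed (simp add: space_PiM)

lemma canonical_measurable [measurable]: "canonical s \<in> paths \<rightarrow>\<^sub>M PiM UNIV (\<lambda>_. borel)"
  unfolding canonical_def[abs_def]
proof (rule measurable_PiM_single')
  fix j :: "nat \<times> bool"
  show "(\<lambda>\<omega>. case j of (k, c) \<Rightarrow> if c then (Y (\<omega> k), Z (\<omega> k))
      else (X (label (turn s k)) (\<omega> k), 0)) \<in> borel_measurable paths"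
    by (cases j; cases "snd j")
      (auto intro!: borel_measurable_Pair measurable_compose[OF coordinate_measurable])
qed (simp add: space_PiM)

abbreviation B_is :: "nat \<Rightarrow> 'a set" where
  "B_is i \<equiv> {\<omega> \<in> space M. B \<omega> = i}"

text \<open>On cylinder sets both laws are products of the marginal laws of \<open>X\<close> and \<open>(Y, Z)\<close>.\<close>

lemma distr_observed_given_B:
  assumes i: "label s = 3 - i" "i \<in> {1, 2}"
  shows "distr (uniform_measure M (B_is i)) (PiM UNIV (\<lambda>_. borel)) observed =
    distr paths (PiM UNIV (\<lambda>_. borel)) (canonical s)"
    (is "?P = ?Q")
proof (rule measure_eqI_PiM_infinite)
  have Bi: "emeasure M (B_is i) = ennreal (1 / 2)"
    unfolding emeasure_eq_measure B_prob[OF i(2)] ..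
  interpret U: prob_space "uniform_measure M (B_is i)"
    by (rule prob_space_uniform_measure) (simp_all add: Bi)
  have obs [measurable]: "observed \<in> uniform_measure M (B_is i) \<rightarrow>\<^sub>M PiM UNIV (\<lambda>_. borel)"
    by (simp cong: measurable_cong_sets)
  interpret P: prob_space ?P
    by (rule U.prob_space_distr) (rule obs)
  show "finite_measure ?P" by (rule P.finite_measure_axioms)
  show "sets ?P = sets (PiM UNIV (\<lambda>_. borel))" "sets ?Q = sets (PiM UNIV (\<lambda>_. borel))"
    by simp_all
  fix A :: "nat \<times> bool \<Rightarrow> (real \<times> real) set" and J
  assume J: "finite J" and A: "\<And>j. j \<in> J \<Longrightarrow> A j \<in> sets borel"
  obtain L where L: "fst ` J \<subseteq> {..<L}"
    using finite_nat_iff_bounded[of "fst ` J"] J by auto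
  \<comment> \<open>Coordinates outside \<open>J\<close> are unrestricted, so any number of steps that covers \<open>J\<close> serves; an odd one fits the pairs of copies.\<close>
  define N where "N = Suc (2 * L)"
  define a where "a k c = (if (k, c) \<in> J then A (k, c) else UNIV)" for k c
  have a: "a k c \<in> sets borel" for k c
    using A by (auto simp: a_def)
  define D where "D k = {t :: real. (t, 0 :: real) \<in> a k False}" for k
  have D: "D k \<in> sets borel" for k
  proof -
    have "(\<lambda>t :: real. (t, 0 :: real)) -` a k False \<inter> space borel \<in> sets borel"
      by (rule measurable_sets[OF _ a]) (intro borel_measurable_Pair; simp)
    then show ?thesis by (simp add: D_def vimage_def)
  qed
  let ?E = "prod_emb UNIV (\<lambda>_. borel) J (Pi\<^sub>E J A)"
  have E: "?E \<in> sets (PiM UNIV (\<lambda>_. borel))"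
    by (rule sets_PiM_I) (use J A in auto)
  have "x \<in> ?E \<longleftrightarrow> (\<forall>j\<in>J. x j \<in> A j)" for x
    by (auto simp: prod_emb_def PiE_iff)
  also have "\<dots> x \<longleftrightarrow> (\<forall>k<N. x (k, False) \<in> a k False \<and> x (k, True) \<in> a k True)" for x
  proof (intro iffI ballI)
    fix j assume *: "\<forall>k<N. x (k, False) \<in> a k False \<and> x (k, True) \<in> a k True" and j: "j \<in> J"
    have "fst j < L" using L j by auto
    then have "fst j < N" by (simp add: N_def)
    with * j show "x j \<in> A j" by (cases j; cases "snd j") (auto simp: a_def split: if_splits)
  qed (auto simp: a_def)
  finally have E_iff: "x \<in> ?E \<longleftrightarrow> (\<forall>k<N. x (k, False) \<in> a k False \<and> x (k, True) \<in> a k True)" for x .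
  let ?p = "\<Prod>k<N. prob {\<omega> \<in> space M. X (label (turn s k)) \<omega> \<in> D k \<and> (Y \<omega>, Z \<omega>) \<in> a k True}"
  have "emeasure ?P ?E = emeasure (uniform_measure M (B_is i)) (observed -` ?E \<inter> space M)"
    using E by (subst emeasure_distr) (auto simp: obs)
  also have "\<dots> = emeasure M (B_is i \<inter> (observed -` ?E \<inter> space M)) / emeasure M (B_is i)"
    using measurable_sets[OF observed_measurable E] by (simp add: emeasure_uniform_measure)
  also have "B_is i \<inter> (observed -` ?E \<inter> space M) = {\<omega> \<in> space M. B \<omega> = i \<and>
      (\<forall>k<N. ar_process B Xs (Suc k) \<omega> \<in> D k \<and> (Ys (Suc k) \<omega>, Zs (Suc k) \<omega>) \<in> a k True)}"
    unfolding vimage_def E_iff by (auto simp: observed_def D_def)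
  also have "emeasure M \<dots> = ennreal (1 / 2 * ?p)"
    unfolding emeasure_eq_measure by (subst prob_steps_given_B[OF i D a N_def]) (rule refl)
  also have "\<dots> / emeasure M (B_is i) = ennreal ?p"
    unfolding Bi by (subst divide_ennreal) (auto intro: prod_nonneg)
  also have "ennreal ?p = (\<Prod>k<N. emeasure M {\<omega> \<in> space M. X (label (turn s k)) \<omega> \<in> D k \<and> (Y \<omega>, Z \<omega>) \<in> a k True})"
    unfolding emeasure_eq_measure by (rule prod_ennreal[symmetric]) simp
  also have "\<dots> = emeasure paths {\<omega> \<in> space paths. \<forall>k\<in>{..<N}.
      \<omega> k \<in> {\<omega> \<in> space M. X (label (turn s k)) \<omega> \<in> D k \<and> (Y \<omega>, Z \<omega>) \<in> a k True}}"
  proof (rule product_prob_space.emeasure_PiM_Collect[symmetric])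
    show "product_prob_space (\<lambda>_ :: nat. M)"
      using sequence_space_paths by (simp add: sequence_space_def)
    note [measurable] = D a
    have [measurable]: "(\<lambda>\<omega>. (Y \<omega>, Z \<omega>)) \<in> borel_measurable M"
      by (intro borel_measurable_Pair) simp_all
    show "{\<omega> \<in> space M. X (label (turn s k)) \<omega> \<in> D k \<and> (Y \<omega>, Z \<omega>) \<in> a k True} \<in> sets M" for k
      by measurable
  qed auto
  also have "{\<omega> \<in> space paths. \<forall>k\<in>{..<N}.
      \<omega> k \<in> {\<omega> \<in> space M. X (label (turn s k)) \<omega> \<in> D k \<and> (Y \<omega>, Z \<omega>) \<in> a k True}} = canonical s -` ?E \<inter> space paths"
    unfolding vimage_def E_iff by (auto simp: canonical_def D_def space_PiM)
  also have "emeasure paths \<dots> = emeasure ?Q ?E"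
    using E by (subst emeasure_distr) simp_all
  finally show "emeasure ?P ?E = emeasure ?Q ?E" .
qed

text \<open>Given \<open>B = i\<close> the first step uses law \<open>3 - i\<close>.\<close>

lemma psi_eq_survival:
  assumes i: "label s = 3 - i" "i \<in> {1, 2}"
  shows "ennreal (psi M B (ar_process B Xs) Ys Zs i p) = survival s p"
proof -
  interpret P: prob_space paths by (rule prob_space_paths)
  define E where "E = {x \<in> space (PiM UNIV (\<lambda>_. borel)). \<forall>n.
      survives (\<lambda>k. fst (x (k, True)) - fst (x (k, False) :: real \<times> real))
        (\<lambda>k. snd (x (k, True)) - fst (x (k, False))) n p}"
  have E: "E \<in> sets (PiM UNIV (\<lambda>_. borel))"
  proof -
    have [measurable]: "(fst :: real \<times> real \<Rightarrow> real) \<in> borel_measurable borel" "(snd :: real \<times> real \<Rightarrow> real) \<in> borel_measurable borel"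
      by (intro borel_measurable_continuous_onI continuous_intros)+
    show ?thesis unfolding E_def by measurable
  qed
  have obs: "observed \<omega> \<in> E \<longleftrightarrow> sup_walk1 (ar_process B Xs) Ys 1 \<omega> \<le> fst p \<and>
      sup_walk2 (ar_process B Xs) Ys Zs 1 \<omega> \<le> snd p" for \<omega>
    unfolding survives_all_iff_sup_walks[symmetric] by (simp add: E_def observed_def space_PiM)
  have can: "canonical s \<omega> \<in> E \<longleftrightarrow> (\<forall>n. survives (alternating U s \<omega>) (alternating V s \<omega>) n p)" for \<omega>
    by (simp add: E_def canonical_def space_PiM alternating_def[abs_def] U_def V_def)
  have Bi: "prob (B_is i) = 1 / 2"
    using B_prob[OF i(2)] by simp
  have "psi M B (ar_process B Xs) Ys Zs i p = measure M (B_is i \<inter> (observed -` E \<inter> space M)) / measure M (B_is i)"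
    unfolding psi_def cond_prob_def split_beta' vimage_def obs
    by (intro arg_cong2[where f="(/)"] arg_cong[where f=prob]) auto
  also have "\<dots> = measure (uniform_measure M (B_is i)) (observed -` E \<inter> space M)"
    using Bi measurable_sets[OF observed_measurable E]
    by (subst measure_uniform_measure) (auto simp: emeasure_eq_measure)
  also have "\<dots> = measure (distr (uniform_measure M (B_is i)) (PiM UNIV (\<lambda>_. borel)) observed) E"
    using E observed_measurable by (subst measure_distr) (auto cong: measurable_cong_sets)
  also have "\<dots> = measure paths (canonical s -` E \<inter> space paths)"
    unfolding distr_observed_given_B[OF i] using E by (subst measure_distr) simp_all
  also have "canonical s -` E \<inter> space paths =
      {\<omega> \<in> space paths. \<forall>n. survives (alternating U s \<omega>) (alternating V s \<omega>) n p}"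
    unfolding vimage_def can by auto
  finally show ?thesis
    unfolding survival_eq_paths
    by (simp add: P.emeasure_eq_measure)
qed

end

section \<open>Solutions and one-sided bounds\<close>

text \<open>A property that also holds at the corner needs no puncture, and the sets \<open>u, v > c\<close> form a neighbourhood base.\<close>

lemma eventually_corner_iff:
  fixes P :: "ereal \<times> ereal \<Rightarrow> bool"
  assumes "P (\<infinity>, \<infinity>)"
  shows "eventually P (at (\<infinity>, \<infinity>)) \<longleftrightarrow>
    (\<exists>c::real. \<forall>u v. ereal c < u \<longrightarrow> ereal c < v \<longrightarrow> P (u, v))"
proof
  assume "eventually P (at (\<infinity>, \<infinity>))"
  then obtain S where S: "open S" "(\<infinity>, \<infinity>) \<in> S" "\<And>p. p \<in> S \<Longrightarrow> p \<noteq> (\<infinity>, \<infinity>) \<Longrightarrow> P p"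
    unfolding eventually_at_topological by blast
  then have S_P: "P p" if "p \<in> S" for p
    using assms that by (cases "p = (\<infinity>, \<infinity>)") auto
  then obtain A B where AB: "open A" "open B" "\<infinity> \<in> A" "\<infinity> \<in> B" "A \<times> B \<subseteq> S"
    using open_prod_elim[OF S(1,2)] by (metis mem_Sigma_iff)
  obtain a b where "{ereal a<..} \<subseteq> A" "{ereal b<..} \<subseteq> B"
    using AB open_PInfty by metis
  then have "\<forall>u v. ereal (max a b) < u \<longrightarrow> ereal (max a b) < v \<longrightarrow> P (u, v)"
    using AB(5) by (intro allI impI S_P) auto
  then show "\<exists>c::real. \<forall>u v. ereal c < u \<longrightarrow> ereal c < v \<longrightarrow> P (u, v)" ..
next
  assume "\<exists>c::real. \<forall>u v. ereal c < u \<longrightarrow> ereal c < v \<longrightarrow> P (u, v)"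
  then obtain c where c: "\<And>u v. ereal c < u \<Longrightarrow> ereal c < v \<Longrightarrow> P (u, v)" by blast
  show "eventually P (at (\<infinity>, \<infinity>))"
    unfolding eventually_at_topological
  proof (intro exI conjI ballI impI)
    show "open ({ereal c<..} \<times> {ereal c<..})" by (intro open_Times) simp_all
  qed (use c in auto)
qed

locale drifting_alternate_renewal = alternate_renewal +
  assumes X_nonneg: "\<And>s. AE \<omega> in M. 0 \<le> X (label s) \<omega>"
    and Y_nonneg: "AE \<omega> in M. 0 \<le> Y \<omega>"
    and Z_nonneg: "AE \<omega> in M. 0 \<le> Z \<omega>"
    and drift: "((\<integral>\<^sup>+\<omega>. ennreal (X 1 \<omega>) \<partial>M) + (\<integral>\<^sup>+\<omega>. ennreal (X 2 \<omega>) \<partial>M)) / 2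
        > max (\<integral>\<^sup>+\<omega>. ennreal (Y \<omega>) \<partial>M) (\<integral>\<^sup>+\<omega>. ennreal (Z \<omega>) \<partial>M)"
    and U_positive: "\<And>s. prob {\<omega> \<in> space M. 0 < Y \<omega> - X (label s) \<omega>} > 0"
begin

sublocale killed_walk_pos M U V
  by unfold_locales (simp add: U_def U_positive[simplified])

lemma integrable_nonneg_finite:
  assumes [measurable]: "f \<in> borel_measurable M" and "AE \<omega> in M. 0 \<le> f \<omega>" "(\<integral>\<^sup>+\<omega>. ennreal (f \<omega>) \<partial>M) < top"
  shows "integrable M f"
  using assms by (intro integrableI_nonneg) (simp_all add: top.not_eq_extremum)

lemma Y_integrable: "integrable M Y" and Z_integrable: "integrable M Z"
proof -
  have "max (\<integral>\<^sup>+\<omega>. ennreal (Y \<omega>) \<partial>M) (\<integral>\<^sup>+\<omega>. ennreal (Z \<omega>) \<partial>M) < top"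
    using drift top_greatest less_le_trans by blast
  then show "integrable M Y" "integrable M Z"
    by (auto intro!: integrable_nonneg_finite Y_nonneg Z_nonneg)
qed

lemma truncated_integrable: "integrable M (\<lambda>\<omega>. min (X (label s) \<omega>) (real n))"
proof (rule integrable_const_bound)
  show "AE \<omega> in M. norm (min (X (label s) \<omega>) (real n)) \<le> real n"
    using X_nonneg[of s] by eventually_elim auto
qed measurable

text \<open>The \<open>X\<close> may have infinite mean. By monotone convergence the average of the means of their truncations at \<open>n\<close>
  exceeds the means of \<open>Y\<close> and \<open>Z\<close> once \<open>n\<close> is large.\<close>

lemma truncated_drift:
  obtains n :: nat where
    "2 * expectation Y < expectation (\<lambda>\<omega>. min (X 1 \<omega>) (real n)) + expectation (\<lambda>\<omega>. min (X 2 \<omega>) (real n))"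
    "2 * expectation Z < expectation (\<lambda>\<omega>. min (X 1 \<omega>) (real n)) + expectation (\<lambda>\<omega>. min (X 2 \<omega>) (real n))"
proof -
  let ?x = "\<lambda>s n. expectation (\<lambda>\<omega>. min (X (label s) \<omega>) (real n))"
  have nn: "(\<integral>\<^sup>+\<omega>. ennreal (min (X (label s) \<omega>) (real n)) \<partial>M) = ennreal (?x s n)" for s n
    using X_nonneg[of s] by (intro nn_integral_eq_integral truncated_integrable) (auto elim: eventually_mono)
  have x_nonneg: "0 \<le> ?x s n" for s n
    using X_nonneg[of s] by (intro integral_nonneg_AE) (auto elim: eventually_mono)
  have lim: "(\<lambda>n. ennreal (?x s n)) \<longlonglongrightarrow> (\<integral>\<^sup>+\<omega>. ennreal (X (label s) \<omega>) \<partial>M)" for s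
    unfolding nn[symmetric]
  proof (rule nn_integral_LIMSEQ)
    show "incseq (\<lambda>n \<omega>. ennreal (min (X (label s) \<omega>) (real n)))"
      by (auto simp: incseq_def le_fun_def intro!: ennreal_leI)
    fix \<omega>
    have "eventually (\<lambda>n. ennreal (min (X (label s) \<omega>) (real n)) = ennreal (X (label s) \<omega>)) sequentially"
    proof -
      obtain N :: nat where "X (label s) \<omega> \<le> real N" using real_arch_simple by blast
      then have "ennreal (min (X (label s) \<omega>) (real n)) = ennreal (X (label s) \<omega>)" if "N \<le> n" for n
        using that by (simp add: min_absorb1 order_trans[of _ "real N"])
      then show ?thesis unfolding eventually_sequentially by blast
    qed
    then show "(\<lambda>n. ennreal (min (X (label s) \<omega>) (real n))) \<longlonglongrightarrow> ennreal (X (label s) \<omega>)"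
      by (rule tendsto_eventually)
  qed measurable
  have "(\<lambda>n. inverse 2 * (ennreal (?x True n) + ennreal (?x False n))) \<longlonglongrightarrow>
      inverse 2 * ((\<integral>\<^sup>+\<omega>. ennreal (X (label True) \<omega>) \<partial>M) + (\<integral>\<^sup>+\<omega>. ennreal (X (label False) \<omega>) \<partial>M))"
    by (intro ennreal_tendsto_cmult tendsto_add lim) (simp add: less_top[symmetric])
  then have "(\<lambda>n. (ennreal (?x True n) + ennreal (?x False n)) / 2) \<longlonglongrightarrow>
      ((\<integral>\<^sup>+\<omega>. ennreal (X 1 \<omega>) \<partial>M) + (\<integral>\<^sup>+\<omega>. ennreal (X 2 \<omega>) \<partial>M)) / 2"
    by (simp add: label_def divide_ennreal_def mult.commute)
  from order_tendstoD(1)[OF this drift] obtain n where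
    n: "max (\<integral>\<^sup>+\<omega>. ennreal (Y \<omega>) \<partial>M) (\<integral>\<^sup>+\<omega>. ennreal (Z \<omega>) \<partial>M) < (ennreal (?x True n) + ennreal (?x False n)) / 2"
    by (auto simp: eventually_sequentially)
  also have "(ennreal (?x True n) + ennreal (?x False n)) / 2 = ennreal ((?x True n + ?x False n) / 2)"
    using x_nonneg by (simp add: divide_ennreal[symmetric] ennreal_plus)
  finally have "ennreal (expectation Y) < ennreal ((?x True n + ?x False n) / 2)"
    "ennreal (expectation Z) < ennreal ((?x True n + ?x False n) / 2)"
    using nn_integral_eq_integral[OF Y_integrable Y_nonneg] nn_integral_eq_integral[OF Z_integrable Z_nonneg]
    by auto
  moreover have "0 \<le> expectation Y" "0 \<le> expectation Z"
    by (intro integral_nonneg_AE Y_nonneg Z_nonneg)+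
  ultimately have "expectation Y < (?x True n + ?x False n) / 2" "expectation Z < (?x True n + ?x False n) / 2"
    by (auto simp: ennreal_less_iff)
  then show thesis
    by (intro that[of n]) (simp_all add: label_def)
qed

lemma survival_corner:
  assumes "e < 1"
  shows "\<exists>c. \<forall>s u v. ereal c \<le> u \<longrightarrow> ereal c \<le> v \<longrightarrow> e \<le> survival s (u, v)"
proof -
  obtain n where n: "2 * expectation Y < expectation (\<lambda>\<omega>. min (X 1 \<omega>) (real n)) + expectation (\<lambda>\<omega>. min (X 2 \<omega>) (real n))"
    "2 * expectation Z < expectation (\<lambda>\<omega>. min (X 1 \<omega>) (real n)) + expectation (\<lambda>\<omega>. min (X 2 \<omega>) (real n))"
    by (rule truncated_drift)
  have diff: "expectation (\<lambda>\<omega>. f \<omega> - min (X (label s) \<omega>) (real n)) =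
      expectation f - expectation (\<lambda>\<omega>. min (X (label s) \<omega>) (real n))" if "integrable M f" for f s
    by (intro Bochner_Integration.integral_diff that truncated_integrable)
  show ?thesis
  proof (rule survival_tends_to_1[where U'="\<lambda>s \<omega>. Y \<omega> - min (X (label s) \<omega>) (real n)"
        and V'="\<lambda>s \<omega>. Z \<omega> - min (X (label s) \<omega>) (real n)"])
    show "integrable M (\<lambda>\<omega>. Y \<omega> - min (X (label s) \<omega>) (real n))"
      "integrable M (\<lambda>\<omega>. Z \<omega> - min (X (label s) \<omega>) (real n))" for s
      by (intro Bochner_Integration.integrable_diff Y_integrable Z_integrable truncated_integrable)+
    show "expectation (\<lambda>\<omega>. Y \<omega> - min (X (label True) \<omega>) (real n)) +
        expectation (\<lambda>\<omega>. Y \<omega> - min (X (label False) \<omega>) (real n)) < 0"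
      "expectation (\<lambda>\<omega>. Z \<omega> - min (X (label True) \<omega>) (real n)) +
        expectation (\<lambda>\<omega>. Z \<omega> - min (X (label False) \<omega>) (real n)) < 0"
      using n unfolding diff[OF Y_integrable] diff[OF Z_integrable] by (simp_all add: label_def)
  qed (simp_all add: U_def V_def assms)
qed

definition \<Psi> :: "bool \<Rightarrow> ereal \<times> ereal \<Rightarrow> real" where
  "\<Psi> s = psi M B (ar_process B Xs) Ys Zs (label s)"

lemma survival_eq: "survival s p = ennreal (\<Psi> (\<not> s) p)"
  using psi_eq_survival[of s "label (\<not> s)" p] label_in[of "\<not> s"]
  by (simp add: \<Psi>_def label_not label_def)

lemma \<Psi>_nonneg: "0 \<le> \<Psi> s p"
  by (simp add: \<Psi>_def psi_def cond_prob_def split_beta')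

lemma \<Psi>_le_1: "\<Psi> s p \<le> 1"
  using survival_le_1[of "\<not> s" p] by (simp add: survival_eq \<Psi>_nonneg)

lemma \<Psi>_measurable [measurable]: "\<Psi> s \<in> borel_measurable borel"
proof -
  have "\<Psi> s = (\<lambda>p. enn2real (survival (\<not> s) p))"
    by (simp add: survival_eq \<Psi>_nonneg)
  also have "\<dots> \<in> borel_measurable borel" by measurable
  finally show ?thesis .
qed

lemma \<Psi>_corner:
  assumes "e > 0"
  shows "\<exists>c. \<forall>s u v. ereal c < u \<longrightarrow> ereal c < v \<longrightarrow> 1 - e \<le> \<Psi> s (u, v)"
proof -
  have "ennreal (1 - e) < 1"
    using assms by (cases "0 \<le> 1 - e") (auto simp: ennreal_less_iff ennreal_neg)
  from survival_corner[OF this] obtain c where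
    c: "\<And>s u v. ereal c \<le> u \<Longrightarrow> ereal c \<le> v \<Longrightarrow> ennreal (1 - e) \<le> survival s (u, v)" by blast
  have "1 - e \<le> \<Psi> s (u, v)" if "ereal c < u" "ereal c < v" for s u v
    using c[of u v "\<not> s"] that by (simp add: survival_eq \<Psi>_nonneg ennreal_le_iff less_imp_le)
  then show ?thesis by blast
qed

lemma \<Psi>_at_corner: "\<Psi> s (\<infinity>, \<infinity>) = 1"
proof (rule antisym)
  show "1 \<le> \<Psi> s (\<infinity>, \<infinity>)"
  proof (rule field_le_epsilon)
    fix e :: real assume "0 < e"
    from \<Psi>_corner[OF this] show "1 \<le> \<Psi> s (\<infinity>, \<infinity>) + e"
      by (auto simp: algebra_simps)
  qed
qed (rule \<Psi>_le_1)

lemma \<Psi>_tendsto: "(\<Psi> s \<longlongrightarrow> 1) (at (\<infinity>, \<infinity>))"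
proof (rule tendstoI)
  fix e :: real assume e: "0 < e"
  then obtain c where c: "\<And>s u v. ereal c < u \<Longrightarrow> ereal c < v \<Longrightarrow> 1 - e / 2 \<le> \<Psi> s (u, v)"
    using \<Psi>_corner[of "e / 2"] by auto
  have "dist (\<Psi> s (u, v)) 1 < e" if "ereal c < u" "ereal c < v" for u v
    using c[OF that, of s] \<Psi>_le_1[of s "(u, v)"] e by (simp add: dist_real_def)
  then show "eventually (\<lambda>p. dist (\<Psi> s p) 1 < e) (at (\<infinity>, \<infinity>))"
    by (subst eventually_corner_iff) (auto simp: \<Psi>_at_corner e)
qed

lemma ar_op_integrand:
  "indicat_real {\<omega>. u + ereal (X (label s) \<omega>) \<ge> ereal (Y \<omega>)} \<omega> *
     f (min (u - ereal (Y \<omega> - X (label s) \<omega>)) (v - ereal (Z \<omega> - X (label s) \<omega>)),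
        v - ereal (Z \<omega> - X (label s) \<omega>)) =
   (if ereal (U s \<omega>) \<le> u then 1 else 0) * f (step (U s \<omega>) (V s \<omega>) (u, v))"
proof -
  have "ereal (Y \<omega>) \<le> u + ereal (X (label s) \<omega>) \<longleftrightarrow> ereal (U s \<omega>) \<le> u"
    by (cases u) (auto simp: U_def)
  then show ?thesis by (simp add: U_def V_def)
qed

lemma ar_op_eq:
  "ar_op M (X (label s)) Y Z f u v =
     ext_expectation M (\<lambda>\<omega>. (if ereal (U s \<omega>) \<le> u then 1 else 0) * f (step (U s \<omega>) (V s \<omega>) (u, v)))"
  unfolding ar_op_def ar_op_integrand ..

lemma nn_integral_ar_op_integrand:
  "(\<integral>\<^sup>+\<omega>. ennreal ((if ereal (U s \<omega>) \<le> u then 1 else 0) * f (step (U s \<omega>) (V s \<omega>) (u, v))) \<partial>M) =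
     kill_op s (\<lambda>p. ennreal (f p)) (u, v)"
  unfolding kill_op_def by (intro nn_integral_cong) auto

lemma ar_op_le_kill_op: "ar_op M (X (label s)) Y Z f u v \<le> enn2ereal (kill_op s (\<lambda>p. ennreal (f p)) (u, v))"
  unfolding ar_op_eq ext_expectation_def nn_integral_ar_op_integrand
  by (rule ereal_diff_le_self) simp

lemma ar_op_nonneg:
  assumes "\<And>p. 0 \<le> f p"
  shows "ar_op M (X (label s)) Y Z f u v = enn2ereal (kill_op s (\<lambda>p. ennreal (f p)) (u, v))"
  unfolding ar_op_eq nn_integral_ar_op_integrand[symmetric]
  by (rule ext_expectation_nonneg) (simp add: assms)

lemma integrable_ar_op_integrand:
  assumes [measurable]: "f \<in> borel_measurable borel" and K: "\<And>p. \<bar>f p\<bar> \<le> (K :: real)"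
  shows "integrable M (\<lambda>\<omega>. (if ereal (U s \<omega>) \<le> u then 1 else 0) * f (step (U s \<omega>) (V s \<omega>) (u, v)))"
proof (rule integrable_const_bound)
  have "0 \<le> K" using K[of "(0, 0)"] by linarith
  then show "AE \<omega> in M. norm ((if ereal (U s \<omega>) \<le> u then 1 else 0) * f (step (U s \<omega>) (V s \<omega>) (u, v))) \<le> K"
    using K by (intro AE_I2) auto
qed measurable

text \<open>Passing to \<^typ>\<open>ennreal\<close> cuts off the negative part of \<open>\<gamma>\<close>. This increases the left-hand side of the inequality, and where \<open>\<gamma>\<close>
  is not positive the inequality becomes trivial.\<close>

lemma sub_solution_le_\<Psi>:
  fixes \<gamma> :: "bool \<Rightarrow> ereal \<times> ereal \<Rightarrow> real"
  assumes [measurable]: "\<And>s. \<gamma> s \<in> borel_measurable borel" and K: "\<And>s p. \<gamma> s p \<le> K"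
    and sub: "\<And>s u v. 0 < \<gamma> (\<not> s) (u, v) \<Longrightarrow> ereal (\<gamma> (\<not> s) (u, v)) \<le> ar_op M (X (label s)) Y Z (\<gamma> s) u v"
    and corner: "\<And>s e. 0 < e \<Longrightarrow> eventually (\<lambda>p. \<gamma> s p < 1 + e) (at (\<infinity>, \<infinity>))"
    and at_corner: "\<And>s. \<gamma> s (\<infinity>, \<infinity>) = 1"
  shows "\<gamma> s p \<le> \<Psi> s p"
proof (rule field_le_epsilon)
  fix e :: real assume e: "0 < e"
  have "\<exists>c. \<forall>u v. ereal c < u \<longrightarrow> ereal c < v \<longrightarrow> \<gamma> s (u, v) < 1 + e" for s
    using corner[OF e, of s] by (subst (asm) eventually_corner_iff) (auto simp: at_corner e)
  then obtain c where c: "\<And>s u v. ereal (c s) < u \<Longrightarrow> ereal (c s) < v \<Longrightarrow> \<gamma> s (u, v) < 1 + e"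
    by metis
  have "ennreal (\<gamma> (\<not> \<not> s) p) \<le> ennreal (1 + e) * survival (\<not> s) p"
  proof (rule sub_solution_le_survival[where g="\<lambda>s p. ennreal (\<gamma> (\<not> s) p)" and K="ennreal K"
        and c="max (c True) (c False)"])
    show "ennreal (\<gamma> (\<not> s) p) \<le> kill_op s (\<lambda>p. ennreal (\<gamma> (\<not> \<not> s) p)) p" for s p
    proof (cases "0 < \<gamma> (\<not> s) p")
      case True
      have "enn2ereal (ennreal (\<gamma> (\<not> s) p)) \<le> ar_op M (X (label s)) Y Z (\<gamma> s) (fst p) (snd p)"
        using sub[of s "fst p" "snd p"] True by (simp add: enn2ereal_ennreal)
      also have "\<dots> \<le> enn2ereal (kill_op s (\<lambda>p. ennreal (\<gamma> s p)) p)"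
        using ar_op_le_kill_op[of s "\<gamma> s" "fst p" "snd p"] by simp
      finally show ?thesis by (simp add: less_eq_ennreal.rep_eq)
    qed (simp add: ennreal_neg)
    show "ennreal (\<gamma> (\<not> s) p) \<le> ennreal (1 + e)"
      if "ereal (max (c True) (c False)) < fst p" "ereal (max (c True) (c False)) < snd p" for s p
    proof -
      have "ereal (c (\<not> s)) < w" if "ereal (max (c True) (c False)) < w" for w
        using that by (cases s) auto
      from c[OF this[OF that(1)] this[OF that(2)]] show ?thesis
        by (intro ennreal_leI) simp
    qed
  qed (auto intro: ennreal_leI K)
  then have "ennreal (\<gamma> s p) \<le> ennreal ((1 + e) * \<Psi> s p)"
    using e by (simp add: survival_eq ennreal_mult \<Psi>_nonneg)
  then have "\<gamma> s p \<le> (1 + e) * \<Psi> s p"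
    using e by (subst (asm) ennreal_le_iff) (simp_all add: \<Psi>_nonneg)
  also have "\<dots> \<le> \<Psi> s p + e"
    using e mult_left_mono[OF \<Psi>_le_1[of s p], of e] by (simp add: distrib_right)
  finally show "\<gamma> s p \<le> \<Psi> s p + e" .
qed

text \<open>The inequality for \<open>\<eta>\<close> is available only where some \<open>\<psi>\<^sub>i\<close> is positive. Replacing \<open>\<eta>\<^sub>i\<close> by 0 where \<open>\<psi>\<^sub>i = 0\<close> repairs this: if \<open>\<psi>\<close>
  vanishes at a point, then by its equation almost every surviving step leads to a point where \<open>\<psi>\<close> vanishes too.
  Near the corner \<open>\<psi> > 0\<close>, so nothing changes there.\<close>

lemma \<Psi>_le_super_solution:
  fixes \<eta> :: "bool \<Rightarrow> ereal \<times> ereal \<Rightarrow> real"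
  assumes [measurable]: "\<And>s. \<eta> s \<in> borel_measurable borel" and nonneg: "\<And>s p. 0 \<le> \<eta> s p"
    and super: "\<And>s u v. 0 < \<Psi> (\<not> s) (u, v) \<Longrightarrow> u \<le> v \<Longrightarrow>
      ar_op M (X (label s)) Y Z (\<eta> s) u v \<le> ereal (\<eta> (\<not> s) (u, v))"
    and corner: "\<And>s e. 0 < e \<Longrightarrow> eventually (\<lambda>p. 1 - e < \<eta> s p) (at (\<infinity>, \<infinity>))"
    and at_corner: "\<And>s. \<eta> s (\<infinity>, \<infinity>) = 1"
    and le: "u \<le> v"
  shows "\<Psi> s (u, v) \<le> \<eta> s (u, v)"
proof (rule field_le_epsilon)
  fix e :: real assume e: "0 < e"
  have "\<exists>c. \<forall>u v. ereal c < u \<longrightarrow> ereal c < v \<longrightarrow> 1 - e < \<eta> s (u, v)" for s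
    using corner[OF e, of s] by (subst (asm) eventually_corner_iff) (auto simp: at_corner e)
  then obtain c where c: "\<And>s u v. ereal (c s) < u \<Longrightarrow> ereal (c s) < v \<Longrightarrow> 1 - e < \<eta> s (u, v)"
    by metis
  \<comment> \<open>Beyond \<open>d\<close> the survival probability is positive, so \<open>h\<close> agrees with \<open>\<eta>\<close> there.\<close>
  obtain d where d: "\<And>s u v. ereal d < u \<Longrightarrow> ereal d < v \<Longrightarrow> 1 - 1 / 2 \<le> \<Psi> s (u, v)"
    using \<Psi>_corner[of "1 / 2"] by auto
  define h where "h s p = (if survival s p = 0 then 0 else ennreal (\<eta> (\<not> s) p))" for s p
  have [measurable]: "h s \<in> borel_measurable borel" for s
    unfolding h_def[abs_def] by measurable
  have "ennreal (1 - e) * survival (\<not> s) (u, v) \<le> h (\<not> s) (u, v)"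
  proof (rule survival_le_super_solution[where h=h and c="max d (max (c True) (c False))"])
    fix s and p :: "ereal \<times> ereal" assume p: "fst p \<le> snd p"
    show "kill_op s (h (\<not> s)) p \<le> h s p"
    proof (cases "survival s p = 0")
      case True
      then have "kill_op s (survival (\<not> s)) p = 0"
        by (simp add: survival_fixed_point[symmetric])
      then have "AE \<omega> in M. (if ereal (U s \<omega>) \<le> fst p then 1 else 0) *
          survival (\<not> s) (step (U s \<omega>) (V s \<omega>) p) = 0"
        unfolding kill_op_def by (subst (asm) nn_integral_0_iff_AE) simp_all
      then have "AE \<omega> in M. (if ereal (U s \<omega>) \<le> fst p then 1 else 0) *
          h (\<not> s) (step (U s \<omega>) (V s \<omega>) p) = 0"
        by eventually_elim (auto simp: h_def split: if_splits)
      then have "kill_op s (h (\<not> s)) p = 0"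
        unfolding kill_op_def by (subst nn_integral_0_iff_AE) simp_all
      then show ?thesis by simp
    next
      case False
      then have pos: "0 < \<Psi> (\<not> s) p"
        using \<Psi>_nonneg[of "\<not> s" p] by (simp add: survival_eq)
      have "kill_op s (h (\<not> s)) p \<le> kill_op s (\<lambda>p. ennreal (\<eta> s p)) p"
        by (rule kill_op_mono) (simp add: h_def)
      also have "enn2ereal \<dots> \<le> enn2ereal (ennreal (\<eta> (\<not> s) p))"
        using super[of s "fst p" "snd p"] pos p ar_op_nonneg[of "\<eta> s" s "fst p" "snd p"]
        by (simp add: nonneg enn2ereal_ennreal)
      then have "kill_op s (\<lambda>p. ennreal (\<eta> s p)) p \<le> ennreal (\<eta> (\<not> s) p)"
        by (simp only: less_eq_ennreal.rep_eq)
      finally show ?thesis using False by (simp add: h_def)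
    qed
  next
    fix s and p :: "ereal \<times> ereal"
    assume p: "ereal (max d (max (c True) (c False))) < fst p" "ereal (max d (max (c True) (c False))) < snd p"
    have w: "ereal (c (\<not> s)) < w" "ereal d < w" if "ereal (max d (max (c True) (c False))) < w" for w
      using that by (cases s; auto)+
    have "survival s p \<noteq> 0"
      using d[OF w(2)[OF p(1)] w(2)[OF p(2)], of "\<not> s"] by (simp add: survival_eq)
    then show "ennreal (1 - e) \<le> h s p"
      using c[OF w(1)[OF p(1)] w(1)[OF p(2)]] by (simp add: h_def ennreal_leI)
  qed (use le in auto)
  also have "\<dots> \<le> ennreal (\<eta> s (u, v))"
    by (simp add: h_def)
  finally have *: "ennreal (1 - e) * ennreal (\<Psi> s (u, v)) \<le> ennreal (\<eta> s (u, v))"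
    by (simp add: survival_eq)
  have "(1 - e) * \<Psi> s (u, v) \<le> \<eta> s (u, v)"
  proof (cases "0 \<le> 1 - e")
    case True
    then show ?thesis
      using * by (simp add: ennreal_mult[symmetric] \<Psi>_nonneg nonneg ennreal_le_iff)
  next
    case False
    then have "(1 - e) * \<Psi> s (u, v) \<le> 0"
      by (simp add: mult_nonpos_nonneg \<Psi>_nonneg)
    then show ?thesis using nonneg[of s "(u, v)"] by linarith
  qed
  moreover have "e * \<Psi> s (u, v) \<le> e"
    using e mult_left_mono[OF \<Psi>_le_1[of s "(u, v)"], of e] by simp
  ultimately show "\<Psi> s (u, v) \<le> \<eta> s (u, v) + e"
    by (simp add: left_diff_distrib)
qed

definition solution :: "(bool \<Rightarrow> ereal \<times> ereal \<Rightarrow> real) \<Rightarrow> bool" where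
  "solution f \<longleftrightarrow> (\<forall>s. f s \<in> borel_measurable borel \<and> bounded (range (f s)) \<and>
     f s (\<infinity>, \<infinity>) = 1 \<and> (f s \<longlongrightarrow> 1) (at (\<infinity>, \<infinity>)) \<and>
     (\<forall>u v. ar_op M (X (label s)) Y Z (f s) u v = ereal (f (\<not> s) (u, v))))"

lemma ar_solution_iff: "ar_solution M X Y Z f \<longleftrightarrow> solution (\<lambda>s. f (label s))"
  unfolding ar_solution_def solution_def all_label label_not ..

lemma \<Psi>_solution: "solution \<Psi>"
  unfolding solution_def
proof (intro allI conjI)
  fix s
  have "norm (\<Psi> s p) \<le> 1" for p
    using \<Psi>_nonneg[of s p] \<Psi>_le_1[of s p] by simp
  then show "bounded (range (\<Psi> s))"
    unfolding bounded_iff by blast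
  fix u v
  have "survival (\<not> s) = (\<lambda>p. ennreal (\<Psi> s p))"
    by (rule ext) (simp add: survival_eq)
  then have "ar_op M (X (label s)) Y Z (\<Psi> s) u v = enn2ereal (kill_op s (survival (\<not> s)) (u, v))"
    by (simp only: ar_op_nonneg[OF \<Psi>_nonneg])
  also have "\<dots> = enn2ereal (survival s (u, v))"
    by (simp only: survival_fixed_point[symmetric])
  also have "\<dots> = ereal (\<Psi> (\<not> s) (u, v))"
    by (simp add: survival_eq enn2ereal_ennreal \<Psi>_nonneg)
  finally show "ar_op M (X (label s)) Y Z (\<Psi> s) u v = ereal (\<Psi> (\<not> s) (u, v))" .
qed (simp_all add: \<Psi>_at_corner \<Psi>_tendsto)

lemma solution_le_\<Psi>:
  assumes f: "solution f"
  shows "f s p \<le> \<Psi> s p"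
proof -
  have "\<exists>K. \<forall>p. f s p \<le> K" for s
  proof -
    obtain K where K: "\<And>p. norm (f s p) \<le> K"
      using f unfolding solution_def bounded_iff by blast
    have "f s p \<le> K" for p
      using K[of p] by simp
    then show ?thesis by blast
  qed
  then obtain K where K: "\<And>s p. f s p \<le> K s" by metis
  show ?thesis
  proof (rule sub_solution_le_\<Psi>[where K="max (K True) (K False)"])
    show "f s p \<le> max (K True) (K False)" for s p
      using K[of s p] by (cases s) auto
    show "eventually (\<lambda>p. f s p < 1 + e) (at (\<infinity>, \<infinity>))" if "0 < e" for s e
    proof (rule order_tendstoD(2))
      show "(f s \<longlongrightarrow> 1) (at (\<infinity>, \<infinity>))" using f unfolding solution_def by blast
    qed (use that in simp)
    show "f s \<in> borel_measurable borel" "f s (\<infinity>, \<infinity>) = 1" for s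
      using f unfolding solution_def by blast+
    have "ar_op M (X (label s)) Y Z (f s) u v = ereal (f (\<not> s) (u, v))" for s u v
      using f unfolding solution_def by blast
    then show "ereal (f (\<not> s) (u, v)) \<le> ar_op M (X (label s)) Y Z (f s) u v" for s u v
      by simp
  qed
qed

text \<open>The class of solutions is affine, so the reflection of \<open>\<phi>\<close> in \<open>\<psi>\<close> is again a solution; it turns the upper bound
  by \<open>\<psi>\<close> into a lower bound.\<close>

lemma solution_reflect:
  assumes f: "solution f"
  shows "solution (\<lambda>s p. 2 * \<Psi> s p - f s p)"
  unfolding solution_def
proof (intro allI conjI)
  fix s
  note [measurable] = f[unfolded solution_def, THEN spec, THEN conjunct1]
  show "(\<lambda>p. 2 * \<Psi> s p - f s p) \<in> borel_measurable borel"
    by measurable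
  obtain K where "\<And>p. norm (f s p) \<le> K"
    using f unfolding solution_def bounded_iff by blast
  then have K: "\<bar>f s p\<bar> \<le> K" for p
    by simp
  have \<Psi>: "\<bar>\<Psi> s p\<bar> \<le> 1" for p
    using \<Psi>_nonneg[of s p] \<Psi>_le_1[of s p] by simp
  have bound: "\<bar>2 * \<Psi> s p - f s p\<bar> \<le> 2 + K" for p
    using K[of p] \<Psi>[of p] by linarith
  then show "bounded (range (\<lambda>p. 2 * \<Psi> s p - f s p))"
    unfolding bounded_iff by auto
  show "2 * \<Psi> s (\<infinity>, \<infinity>) - f s (\<infinity>, \<infinity>) = 1"
    using f by (simp add: solution_def \<Psi>_at_corner)
  have "((\<lambda>p. 2 * \<Psi> s p - f s p) \<longlongrightarrow> 2 * 1 - 1) (at (\<infinity>, \<infinity>))"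
    using f by (intro tendsto_intros \<Psi>_tendsto) (simp add: solution_def)
  then show "((\<lambda>p. 2 * \<Psi> s p - f s p) \<longlongrightarrow> 1) (at (\<infinity>, \<infinity>))"
    by simp
  fix u v
  let ?I = "\<lambda>g \<omega>. (if ereal (U s \<omega>) \<le> u then 1 else 0) * g (step (U s \<omega>) (V s \<omega>) (u, v)) :: real"
  have ints: "integrable M (?I (\<Psi> s))" "integrable M (?I (f s))" "integrable M (?I (\<lambda>p. 2 * \<Psi> s p - f s p))"
    by (rule integrable_ar_op_integrand[where f="\<Psi> s", OF _ \<Psi>], measurable)
      (rule integrable_ar_op_integrand[where f="f s", OF _ K], measurable,
       rule integrable_ar_op_integrand[where f="\<lambda>p. 2 * \<Psi> s p - f s p", OF _ bound], measurable)
  have "ar_op M (X (label s)) Y Z (\<Psi> s) u v = ereal (\<Psi> (\<not> s) (u, v))"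
    "ar_op M (X (label s)) Y Z (f s) u v = ereal (f (\<not> s) (u, v))"
    using \<Psi>_solution f unfolding solution_def by blast+
  then have eqs: "integral\<^sup>L M (?I (\<Psi> s)) = \<Psi> (\<not> s) (u, v)" "integral\<^sup>L M (?I (f s)) = f (\<not> s) (u, v)"
    unfolding ar_op_eq ext_expectation_integrable[OF ints(1)] ext_expectation_integrable[OF ints(2)]
    by (simp_all only: ereal.inject)
  have "integral\<^sup>L M (?I (\<lambda>p. 2 * \<Psi> s p - f s p)) = integral\<^sup>L M (\<lambda>\<omega>. 2 * ?I (\<Psi> s) \<omega> - ?I (f s) \<omega>)"
    by (rule Bochner_Integration.integral_cong[OF refl]) (simp del: step.simps)
  also have "\<dots> = integral\<^sup>L M (\<lambda>\<omega>. 2 * ?I (\<Psi> s) \<omega>) - integral\<^sup>L M (?I (f s))"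
    by (intro Bochner_Integration.integral_diff integrable_mult_right ints)
  also have "\<dots> = 2 * \<Psi> (\<not> s) (u, v) - f (\<not> s) (u, v)"
    by (simp only: integral_mult_right_zero eqs)
  finally show "ar_op M (X (label s)) Y Z (\<lambda>p. 2 * \<Psi> s p - f s p) u v = ereal (2 * \<Psi> (\<not> s) (u, v) - f (\<not> s) (u, v))"
    unfolding ar_op_eq ext_expectation_integrable[OF ints(3)] by (simp only: ereal.inject)
qed

lemma solution_unique:
  assumes "solution f"
  shows "f s p = \<Psi> s p"
  using solution_le_\<Psi>[OF assms, of s p] solution_le_\<Psi>[OF solution_reflect[OF assms], of s p] by simp

end

theorem theorem8:
  fixes M :: "'a measure"
    and X :: "nat \<Rightarrow> 'a \<Rightarrow> real" and Y Z :: "'a \<Rightarrow> real"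
    and B :: "'a \<Rightarrow> nat"
    and Xs :: "nat \<Rightarrow> nat \<Rightarrow> 'a \<Rightarrow> real" and Ys Zs :: "nat \<Rightarrow> 'a \<Rightarrow> real"
    and \<psi> :: "nat \<Rightarrow> ereal \<times> ereal \<Rightarrow> real"
  assumes M: "prob_space M"
    and indep_XYZ: "prob_space.indep_vars M (\<lambda>_. borel) (\<lambda>j. [X 1, X 2, Y, Z] ! j) {..<4}"
    and X_nonneg: "\<And>i. i \<in> {1, 2} \<Longrightarrow> AE \<omega> in M. 0 \<le> X i \<omega>"
    and Y_nonneg: "AE \<omega> in M. 0 \<le> Y \<omega>"
    and Z_nonneg: "AE \<omega> in M. 0 \<le> Z \<omega>"
    and drift: "((\<integral>\<^sup>+\<omega>. ennreal (X 1 \<omega>) \<partial>M) + (\<integral>\<^sup>+\<omega>. ennreal (X 2 \<omega>) \<partial>M)) / 2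
        > max (\<integral>\<^sup>+\<omega>. ennreal (Y \<omega>) \<partial>M) (\<integral>\<^sup>+\<omega>. ennreal (Z \<omega>) \<partial>M)"
    and U_pos: "\<And>i. i \<in> {1, 2} \<Longrightarrow> \<P>(\<omega> in M. Y \<omega> - X i \<omega> > 0) > 0"
    and V_pos: "\<And>i. i \<in> {1, 2} \<Longrightarrow> \<P>(\<omega> in M. Z \<omega> - X i \<omega> > 0) > 0"
    and B_prob: "\<And>i. i \<in> {1, 2} \<Longrightarrow> \<P>(\<omega> in M. B \<omega> = i) = 1 / 2"
    and Xs_indep: "prob_space.indep_vars M (\<lambda>_. borel) (\<lambda>k \<omega>. (Xs 1 k \<omega>, Xs 2 k \<omega>)) UNIV"
    and Xs_distr: "\<And>k. distr M borel (\<lambda>\<omega>. (Xs 1 k \<omega>, Xs 2 k \<omega>)) =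
        distr M borel (\<lambda>\<omega>. (X 1 \<omega>, X 2 \<omega>))"
    and B_indep: "indep_rv M (count_space UNIV) B
        (PiM UNIV (\<lambda>_. borel)) (\<lambda>\<omega> k. (Xs 1 k \<omega>, Xs 2 k \<omega>))"
    and YZs_indep: "prob_space.indep_vars M (\<lambda>_. borel) (\<lambda>k \<omega>. (Ys k \<omega>, Zs k \<omega>)) {1..}"
    and YZs_distr: "\<And>k. k \<ge> 1 \<Longrightarrow> distr M borel (\<lambda>\<omega>. (Ys k \<omega>, Zs k \<omega>)) =
        distr M borel (\<lambda>\<omega>. (Y \<omega>, Z \<omega>))"
    and YZs_XB_indep: "indep_rv M
        (PiM {1..} (\<lambda>_. borel)) (\<lambda>\<omega>. \<lambda>k\<in>{1..}. (Ys k \<omega>, Zs k \<omega>))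
        (PiM UNIV (\<lambda>_. borel) \<Otimes>\<^sub>M count_space UNIV) (\<lambda>\<omega>. (\<lambda>k. ar_process B Xs k \<omega>, B \<omega>))"
    and psi_eq: "\<psi> = psi M B (ar_process B Xs) Ys Zs"
  shows
    "(ar_solution M X Y Z \<psi> \<and>
        (\<forall>\<phi>. ar_solution M X Y Z \<phi> \<longrightarrow> (\<forall>i\<in>{1, 2}. \<phi> i = \<psi> i)))
     \<and>
     (\<forall>(\<gamma> :: nat \<Rightarrow> ereal \<times> ereal \<Rightarrow> real) K.
        (\<forall>i\<in>{1, 2}. \<gamma> i \<in> borel_measurable borel \<and> (\<forall>p. \<gamma> i p \<le> K)) \<and>
        (\<forall>(u, v)\<in>support_on UNIV (\<lambda>p. max (max (\<gamma> 1 p) (\<gamma> 2 p)) 0). \<forall>i\<in>{1, 2}.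
           ar_op M (X i) Y Z (\<gamma> i) u v \<ge> ereal (\<gamma> (3 - i) (u, v))) \<and>
        (\<forall>i\<in>{1, 2}. \<gamma> i (\<infinity>, \<infinity>) = 1 \<and>
           Limsup (at (\<infinity>, \<infinity>)) (\<lambda>p. ereal (\<gamma> i p)) = 1)
        \<longrightarrow> (\<forall>i\<in>{1, 2}. \<forall>p. \<psi> i p \<ge> \<gamma> i p))
     \<and>
     (\<forall>\<eta> :: nat \<Rightarrow> ereal \<times> ereal \<Rightarrow> real.
        (\<forall>i\<in>{1, 2}. \<eta> i \<in> borel_measurable borel \<and> (\<forall>p. 0 \<le> \<eta> i p)) \<and>
        (\<forall>(u, v)\<in>support_on UNIV (\<lambda>p. max (\<psi> 1 p) (\<psi> 2 p)). v \<ge> u \<longrightarrow> (\<forall>i\<in>{1, 2}.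
           ar_op M (X i) Y Z (\<eta> i) u v \<le> ereal (\<eta> (3 - i) (u, v)))) \<and>
        (\<forall>i\<in>{1, 2}. \<eta> i (\<infinity>, \<infinity>) = 1 \<and>
           Liminf (at (\<infinity>, \<infinity>)) (\<lambda>p. ereal (\<eta> i p)) = 1)
        \<longrightarrow> (\<forall>i\<in>{1, 2}. \<forall>u v. v \<ge> u \<longrightarrow> \<psi> i (u, v) \<le> \<eta> i (u, v)))"
proof -
  interpret prob_space M by (rule M)
  have in12: "label s \<in> {1, 2}" for s by (rule label_in)
  interpret drifting_alternate_renewal M X Y Z B Xs Ys Zs
  proof unfold_locales
    show "prob {\<omega> \<in> space M. 0 < Y \<omega> - X (label s) \<omega>} > 0" for s
      by (rule U_pos) (rule in12)
    show "AE \<omega> in M. 0 \<le> X (label s) \<omega>" for s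
      by (rule X_nonneg) (rule in12)
  qed (fact indep_XYZ B_prob Xs_indep Xs_distr B_indep YZs_indep YZs_distr YZs_XB_indep Y_nonneg Z_nonneg drift)+
  have \<psi>: "\<psi> (label s) = \<Psi> s" for s
    by (simp add: psi_eq \<Psi>_def)
  have \<psi>12: "\<psi> 1 = \<Psi> True" "\<psi> 2 = \<Psi> False"
    using \<psi>[of True] \<psi>[of False] by (simp_all add: label_def)
  have support_iff: "(\<forall>(u, v)\<in>support_on UNIV f. P u v) \<longleftrightarrow> (\<forall>u v. f (u, v) \<noteq> 0 \<longrightarrow> P u v)"
    for f :: "ereal \<times> ereal \<Rightarrow> real" and P
    by (auto simp: support_on_def)
  \<comment> \<open>The four cases are existence, uniqueness, the lower bound (b) and the upper bound (c).\<close>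
  show ?thesis
  proof (intro conjI allI impI, goal_cases)
    case 1
    show ?case
      unfolding ar_solution_iff \<psi> by (rule \<Psi>_solution)
  next
    case (2 \<phi>)
    then show ?case
      unfolding ar_solution_iff all_label \<psi> by (auto dest: solution_unique)
  next
    case (3 \<gamma> K)
    then have hyp: "\<And>s. \<gamma> (label s) \<in> borel_measurable borel" "\<And>s p. \<gamma> (label s) p \<le> K"
      "\<And>u v s. max (max (\<gamma> 1 (u, v)) (\<gamma> 2 (u, v))) 0 \<noteq> 0 \<Longrightarrow>
        ereal (\<gamma> (label (\<not> s)) (u, v)) \<le> ar_op M (X (label s)) Y Z (\<gamma> (label s)) u v"
      "\<And>s. \<gamma> (label s) (\<infinity>, \<infinity>) = 1" "\<And>s. Limsup (at (\<infinity>, \<infinity>)) (\<lambda>p. ereal (\<gamma> (label s) p)) = 1"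
      unfolding support_iff all_label label_not by blast+
    have "\<gamma> (label s) p \<le> \<Psi> s p" for s p
    proof (rule sub_solution_le_\<Psi>[where \<gamma>="\<lambda>s. \<gamma> (label s)" and K=K])
      show "eventually (\<lambda>p. \<gamma> (label s) p < 1 + e) (at (\<infinity>, \<infinity>))" if "0 < e" for s e
      proof -
        have "Limsup (at (\<infinity>, \<infinity>)) (\<lambda>p. ereal (\<gamma> (label s) p)) < ereal (1 + e)"
          using that by (simp add: hyp)
        then have "eventually (\<lambda>p. ereal (\<gamma> (label s) p) < ereal (1 + e)) (at (\<infinity>, \<infinity>))"
          by (rule Limsup_lessD)
        then show ?thesis by simp
      qed
      show "ereal (\<gamma> (label (\<not> s)) (u, v)) \<le> ar_op M (X (label s)) Y Z (\<gamma> (label s)) u v"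
        if "0 < \<gamma> (label (\<not> s)) (u, v)" for s u v
        using that by (intro hyp(3)) (auto simp: label_def max_def split: if_splits)
    qed (simp_all add: hyp)
    then show ?case unfolding all_label \<psi> by blast
  next
    case (4 \<eta>)
    then have hyp: "\<And>s. \<eta> (label s) \<in> borel_measurable borel" "\<And>s p. 0 \<le> \<eta> (label s) p"
      "\<And>u v s. max (\<Psi> True (u, v)) (\<Psi> False (u, v)) \<noteq> 0 \<Longrightarrow> u \<le> v \<Longrightarrow>
        ar_op M (X (label s)) Y Z (\<eta> (label s)) u v \<le> ereal (\<eta> (label (\<not> s)) (u, v))"
      "\<And>s. \<eta> (label s) (\<infinity>, \<infinity>) = 1" "\<And>s. Liminf (at (\<infinity>, \<infinity>)) (\<lambda>p. ereal (\<eta> (label s) p)) = 1"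
      unfolding support_iff all_label label_not \<psi>12 by blast+
    have "\<Psi> s (u, v) \<le> \<eta> (label s) (u, v)" if "u \<le> v" for s u v
    proof (rule \<Psi>_le_super_solution[where \<eta>="\<lambda>s. \<eta> (label s)"])
      show "eventually (\<lambda>p. 1 - e < \<eta> (label s) p) (at (\<infinity>, \<infinity>))" if "0 < e" for s e
      proof -
        have "ereal (1 - e) < Liminf (at (\<infinity>, \<infinity>)) (\<lambda>p. ereal (\<eta> (label s) p))"
          using that by (simp add: hyp)
        then have "eventually (\<lambda>p. ereal (1 - e) < ereal (\<eta> (label s) p)) (at (\<infinity>, \<infinity>))"
          by (rule less_LiminfD)
        then show ?thesis by simp
      qed
      show "ar_op M (X (label s)) Y Z (\<eta> (label s)) u v \<le> ereal (\<eta> (label (\<not> s)) (u, v))"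
        if "0 < \<Psi> (\<not> s) (u, v)" "u \<le> v" for s u v
      proof (rule hyp(3))
        have "\<Psi> (\<not> s) (u, v) \<le> max (\<Psi> True (u, v)) (\<Psi> False (u, v))"
          by (cases s) auto
        with that show "max (\<Psi> True (u, v)) (\<Psi> False (u, v)) \<noteq> 0" by linarith
      qed (rule that)
    qed (simp_all add: hyp that)
    then show ?case unfolding all_label \<psi> by blast
  qed
qed

end
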